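(* For any two positive integers $d$ and $n$, there exists a $d$-hypertree $T$ on $[n]$ with $\mu(T) \geq c_d\binom{n-1}{d}$, where $c_d = 16\cdot (48)^{-3^{d-1}}$.
   Context: All chains are over $\mathbb{F}_2$ and identified with their supports (sets of simplices). A $d$-simplex is a $(d+1)$-element subset of $[n]$; $K_n^d$ denotes the set of all $d$-simplices on $[n]$. The boundary $\partial X$ of a set $X$ of $d$-simplices is the set of $(d-1)$-simplices contained in an odd number of members of $X$. A $d$-cycle is a set $Z$ with $\partial Z=\emptyset$. A $d$-forest is a set of $d$-simplices no nonempty subset of which is a $d$-cycle; a $d$-hypertree on $[n]$ is an inclusion-maximal $d$-forest in $K_n^d$. For a $d$-hypertree $T$ and $\sigma\in K_n^d$, $\mathrm{Fill}(\sigma,T)$ is the unique subset $F\subseteq T$ with $\partial F=\partial\sigma$. The average filling-volume is $\mu(T) = \binom{n}{d+1}^{-1}\sum_{\sigma\in K_n^d}|\mathrm{Fill}(\sigma,T)|$. *)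

theory Defs
  imports Complex_Main
begin

(* [n] is {1..n}. Chains over the two-element field are identified with their supports. *)

definition simplices :: "nat \<Rightarrow> nat \<Rightarrow> nat set set" where
  "simplices d n = {\<sigma>. \<sigma> \<subseteq> {1..n} \<and> card \<sigma> = d + 1}"

(* Boundary of a finite set X of d-simplices, for d >= 1: its members are
   (d-1)-simplices, that is, vertex sets of cardinality d. *)
definition boundary :: "nat \<Rightarrow> nat set set \<Rightarrow> nat set set" where
  "boundary d X = {\<tau>. card \<tau> = d \<and> odd (card {\<sigma> \<in> X. \<tau> \<subseteq> \<sigma>})}"

definition cycle :: "nat \<Rightarrow> nat \<Rightarrow> nat set set \<Rightarrow> bool" where
  "cycle d n Z \<longleftrightarrow> Z \<subseteq> simplices d n \<and> boundary d Z = {}"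

definition forest :: "nat \<Rightarrow> nat \<Rightarrow> nat set set \<Rightarrow> bool" where
  "forest d n F \<longleftrightarrow> F \<subseteq> simplices d n \<and> (\<forall>Z. Z \<subseteq> F \<and> Z \<noteq> {} \<longrightarrow> \<not> cycle d n Z)"

definition hypertree :: "nat \<Rightarrow> nat \<Rightarrow> nat set set \<Rightarrow> bool" where
  "hypertree d n T \<longleftrightarrow> forest d n T \<and> (\<forall>F. forest d n F \<and> T \<subseteq> F \<longrightarrow> F = T)"

(* Meaningful when T is a hypertree on [n] and \<sigma> is a d-simplex on [n];
   the filling then exists and is unique. *)
definition Fill :: "nat \<Rightarrow> nat set \<Rightarrow> nat set set \<Rightarrow> nat set set" where
  "Fill d \<sigma> T = (THE F. F \<subseteq> T \<and> boundary d F = boundary d {\<sigma>})"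

(* For n <= d there are no d-simplices, and the value is 0 since division by 0 yields 0. *)
definition avg_fill :: "nat \<Rightarrow> nat \<Rightarrow> nat set set \<Rightarrow> real" where
  "avg_fill d n T =
     (\<Sum>\<sigma>\<in>simplices d n. real (card (Fill d \<sigma> T))) / real (n choose (d + 1))"

definition c_const :: "nat \<Rightarrow> real" where
  "c_const d = 16 * 48 powi (- (3 ^ (d - 1)))"

end

(* A random d-hypertree is built by recursion: for d = 1 take a random Hamiltonian path, and
   for d + 1 choose a random vertex v, a random d-hypertree A and a random (d+1)-hypertree B, both on
   the remaining vertices, and take T = v*A + B. To fill a d-cycle Z in T, fill its link at v by
   F inside A; then v*F is part of the filling, and the residual cycle (Z - star(v)) + F remains to be
   filled in B. Every d-simplex lies in A with probability at most (d+1)/(n-1), so the residual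
   cycle rarely loses vertices of Z, and F itself typically touches a constant fraction of the
   vertices. Hence, after the first vertex hitting Z has been eliminated, a constant fraction of the
   next steps hit the residual cycle, each contributing a filling F of size of order n^d. If b is the
   constant of proportionality for d, this yields b^2/8 for d + 1; starting with b = 1/3 one
   gets 8 * 24^(-2^(d-1)), which is at least c_d. *)
theory Submission
  imports Defs "HOL-Probability.Probability_Mass_Function" "HOL-Combinatorics.Multiset_Permutations"
begin

subsection \<open>Cycles, links and fillings\<close>

text \<open>Randomness is forced by the induction: in a fixed hypertree the boundary of one of its
  own simplices is filled by that simplex alone, so a large lower bound for all nonzero cycles can
  hold only in expectation. The induction carries three bounds: on the size of fillings, on their
  support, and on the probability that a given simplex lies in the random basis. The last one limits
  the cancellation between \<open>F\<close> and the rest of \<open>Z\<close>. The obstacle is that a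
  cycle may have as few as \<open>k + 3\<close> vertices, so a bound proportional to its support is
  too weak for it. Such a bound is still the right tool: being linear in the fraction of supporting
  vertices, it survives the elimination of a random vertex, with constant \<open>b / 2\<close>
  (\<open>fills_support\<close>). It is applied not to \<open>Z\<close> but to the residual cycle
  after the first hit. If there are enough vertices, the expected support of that cycle is at least
  \<open>b / 2\<close> times the number of vertices left, which gives \<open>b^2 / 4\<close>. Steps
  that miss \<open>Z\<close> merely use up vertices; paying for them costs the last factor
  2.\<close>

text \<open>
  A chain \<open>L\<close> as below consists of vertex sets of cardinality \<open>k + 1\<close>, whereas a basis \<open>T\<close> has members of
  cardinality \<open>k + 2\<close>: the index \<open>k\<close> is \<open>d - 1\<close> for a hypertree of dimension \<open>d\<close>. For \<open>k = 0\<close> the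
  boundary is the augmentation, so that cycles are vertex sets of even size.
\<close>

definition is_cycle :: "nat \<Rightarrow> nat set \<Rightarrow> nat set set \<Rightarrow> bool" where
  "is_cycle k V L \<longleftrightarrow> L \<subseteq> {\<sigma>. \<sigma> \<subseteq> V \<and> card \<sigma> = Suc k} \<and> boundary k L = {}"

text \<open>Independence and spanning: \<open>boundary\<close> maps the subsets of \<open>T\<close>
  bijectively onto the cycles one dimension lower. Spanning replaces the maximality of a hypertree
  because it provides fillings at once and passes to cones. The vertex set is arbitrary, since
  vertices are removed one at a time.\<close>

definition cycle_basis :: "nat \<Rightarrow> nat set \<Rightarrow> nat set set \<Rightarrow> bool" where
  "cycle_basis k V T \<longleftrightarrow>
     T \<subseteq> {\<sigma>. \<sigma> \<subseteq> V \<and> card \<sigma> = Suc (Suc k)} \<and>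
     (\<forall>Z\<subseteq>T. boundary (Suc k) Z = {} \<longrightarrow> Z = {}) \<and>
     (\<forall>L. is_cycle k V L \<longrightarrow> (\<exists>F\<subseteq>T. boundary (Suc k) F = L))"

definition filling :: "nat \<Rightarrow> nat set set \<Rightarrow> nat set set \<Rightarrow> nat set set" where
  "filling k L T = (THE F. F \<subseteq> T \<and> boundary (Suc k) F = L)"

definition link :: "nat \<Rightarrow> nat set set \<Rightarrow> nat set set" where
  "link v Z = {\<tau>. v \<notin> \<tau> \<and> insert v \<tau> \<in> Z}"

definition deletion :: "nat \<Rightarrow> nat set set \<Rightarrow> nat set set" where
  "deletion v Z = {\<sigma> \<in> Z. v \<notin> \<sigma>}"

lemma boundary_empty [simp]: "boundary k {} = {}"
  by (simp add: boundary_def)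

lemma odd_card_sym_diff:
  assumes "finite A" "finite B"
  shows "odd (card (sym_diff A B)) \<longleftrightarrow> odd (card A) \<noteq> odd (card B)"
proof -
  have "card (sym_diff A B) = card (A - B) + card (B - A)"
    using assms by (intro card_Un_disjoint) auto
  moreover have "card A = card (A - B) + card (A \<inter> B)" "card B = card (B - A) + card (A \<inter> B)"
    using card_Int_Diff[OF assms(1), of B] card_Int_Diff[OF assms(2), of A] by (simp_all add: Int_commute)
  ultimately show ?thesis by presburger
qed

lemma boundary_sym_diff:
  assumes "finite X" "finite Y"
  shows "boundary k (sym_diff X Y) = sym_diff (boundary k X) (boundary k Y)"
proof -
  have "odd (card {\<sigma> \<in> sym_diff X Y. \<tau> \<subseteq> \<sigma>}) \<longleftrightarrow>
      odd (card {\<sigma> \<in> X. \<tau> \<subseteq> \<sigma>}) \<noteq> odd (card {\<sigma> \<in> Y. \<tau> \<subseteq> \<sigma>})" for \<tau>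
  proof -
    have "{\<sigma> \<in> sym_diff X Y. \<tau> \<subseteq> \<sigma>} = sym_diff {\<sigma> \<in> X. \<tau> \<subseteq> \<sigma>} {\<sigma> \<in> Y. \<tau> \<subseteq> \<sigma>}"
      by auto
    then show ?thesis using odd_card_sym_diff[of "{\<sigma> \<in> X. \<tau> \<subseteq> \<sigma>}" "{\<sigma> \<in> Y. \<tau> \<subseteq> \<sigma>}"] assms
      by (simp only: finite_Collect_conjI simp_thms Collect_mem_eq)
  qed
  then show ?thesis unfolding boundary_def by blast
qed

lemma finite_simplex_sets: "finite V \<Longrightarrow> X \<subseteq> {\<sigma>. \<sigma> \<subseteq> V \<and> card \<sigma> = m} \<Longrightarrow> finite X"
  by (rule finite_subset[of _ "Pow V"]) auto

lemma cycle_basis_unique: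
  assumes "cycle_basis k V T" "finite V" "F \<subseteq> T" "G \<subseteq> T"
    and "boundary (Suc k) F = boundary (Suc k) G"
  shows "F = G"
proof -
  have fin: "finite F" "finite G"
    using assms finite_simplex_sets[OF assms(2)] unfolding cycle_basis_def by (meson order_trans)+
  have "boundary (Suc k) (sym_diff F G) = {}"
    using boundary_sym_diff[OF fin] assms by simp
  moreover have "sym_diff F G \<subseteq> T" using assms by auto
  ultimately have "sym_diff F G = {}" using assms(1) unfolding cycle_basis_def by blast
  then show ?thesis by auto
qed

lemma filling_eqI:
  assumes "cycle_basis k V T" "finite V" "F \<subseteq> T" "boundary (Suc k) F = L"
  shows "filling k L T = F"
  unfolding filling_def using assms cycle_basis_unique by (intro the_equality) metis+

lemma filling_works:
  assumes "cycle_basis k V T" "finite V" "is_cycle k V L"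
  shows "filling k L T \<subseteq> T" "boundary (Suc k) (filling k L T) = L"
proof -
  obtain F where "F \<subseteq> T" "boundary (Suc k) F = L"
    using assms(1,3) unfolding cycle_basis_def by blast
  with filling_eqI[OF assms(1,2) this]
  show "filling k L T \<subseteq> T" "boundary (Suc k) (filling k L T) = L" by simp_all
qed

lemma filling_empty:
  assumes "cycle_basis k V T" "finite V"
  shows "filling k {} T = {}"
  using filling_eqI[OF assms, of "{}"] by simp

lemma is_cycle_finite: "is_cycle k V Z \<Longrightarrow> finite V \<Longrightarrow> finite Z"
  unfolding is_cycle_def using finite_simplex_sets by blast

lemma is_cycle_support: "is_cycle k V Z \<Longrightarrow> \<Union>Z \<subseteq> V"
  unfolding is_cycle_def by auto

section \<open>Links and deletions of a vertex\<close>

lemma link_nonempty: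
  assumes "v \<in> \<Union>Z"
  shows "link v Z \<noteq> {}"
proof -
  obtain \<sigma> where "\<sigma> \<in> Z" "v \<in> \<sigma>" using assms by auto
  then have "\<sigma> - {v} \<in> link v Z" by (auto simp: link_def insert_absorb)
  then show ?thesis by auto
qed

text \<open>For \<open>v\<close> outside \<tau>, inserting \<open>v\<close> matches the members of
  the link above \<tau> with the members of \<open>Z\<close> above \<open>insert v \<tau>\<close>,
  whose number is even.\<close>

lemma is_cycle_link:
  assumes "finite V" "is_cycle (Suc k) V Z"
  shows "is_cycle k (V - {v}) (link v Z)"
proof -
  have Z: "\<sigma> \<subseteq> V" "card \<sigma> = Suc (Suc k)" "finite \<sigma>" if "\<sigma> \<in> Z" for \<sigma>
    using that assms unfolding is_cycle_def by (auto intro: finite_subset)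
  have "link v Z \<subseteq> {\<sigma>. \<sigma> \<subseteq> V - {v} \<and> card \<sigma> = Suc k}"
    unfolding link_def using Z by (force dest: Z simp: card_insert_if)
  moreover have "\<not> odd (card {\<sigma> \<in> link v Z. \<tau> \<subseteq> \<sigma>})" if "card \<tau> = k" for \<tau>
  \<comment> \<open>For \<open>k = 0\<close> infinite \<tau> also satisfy
    \<open>card \<tau> = k\<close>, because infinite sets have cardinality 0.\<close>
  proof (cases "finite \<tau> \<and> v \<notin> \<tau>")
    case True
    have "bij_betw (insert v) {\<sigma> \<in> link v Z. \<tau> \<subseteq> \<sigma>} {\<sigma> \<in> Z. insert v \<tau> \<subseteq> \<sigma>}"
      by (rule bij_betw_byWitness[where f' = "\<lambda>\<sigma>. \<sigma> - {v}"])
        (use True in \<open>auto simp: link_def insert_absorb\<close>)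
    then have "card {\<sigma> \<in> link v Z. \<tau> \<subseteq> \<sigma>} = card {\<sigma> \<in> Z. insert v \<tau> \<subseteq> \<sigma>}"
      by (rule bij_betw_same_card)
    moreover have "card (insert v \<tau>) = Suc k" using True that by simp
    ultimately show ?thesis using assms(2) unfolding is_cycle_def boundary_def by auto
  next
    case False
    have "{\<sigma> \<in> link v Z. \<tau> \<subseteq> \<sigma>} = {}"
    proof (rule ccontr)
      assume "{\<sigma> \<in> link v Z. \<tau> \<subseteq> \<sigma>} \<noteq> {}"
      then obtain \<sigma> where "v \<notin> \<sigma>" "insert v \<sigma> \<in> Z" "\<tau> \<subseteq> \<sigma>" unfolding link_def by auto
      then show False using False Z(3)[of "insert v \<sigma>"] finite_subset by auto
    qed
    then show ?thesis by (simp del: Collect_empty_eq)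
  qed
  ultimately show ?thesis unfolding is_cycle_def boundary_def by (intro conjI) auto
qed

lemma card_cofaces_vertex:
  assumes "finite \<tau>" "v \<notin> \<tau>" "\<And>\<sigma>. \<sigma> \<in> Z \<Longrightarrow> card \<sigma> = Suc (card \<tau>)"
  shows "{\<sigma> \<in> Z. \<tau> \<subseteq> \<sigma> \<and> v \<in> \<sigma>} = (if insert v \<tau> \<in> Z then {insert v \<tau>} else {})"
proof -
  have "\<sigma> = insert v \<tau>" if "\<sigma> \<in> Z" "\<tau> \<subseteq> \<sigma>" "v \<in> \<sigma>" for \<sigma>
  proof -
    have "finite \<sigma>" using assms(3)[OF that(1)] by (simp add: card_ge_0_finite)
    moreover have "insert v \<tau> \<subseteq> \<sigma>" using that by auto
    moreover have "card (insert v \<tau>) = card \<sigma>" using assms that by simp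
    ultimately show ?thesis using card_subset_eq by blast
  qed
  then show ?thesis using assms(2) by auto
qed

text \<open>A face avoiding \<open>v\<close> has an even number of cofaces in \<open>Z\<close>, at
  most one of which contains \<open>v\<close>. Removing the star of \<open>v\<close> therefore
  changes the parity exactly at the faces in the link.\<close>

lemma boundary_deletion:
  assumes "finite V" "is_cycle (Suc k) V Z"
  shows "boundary (Suc k) (deletion v Z) = link v Z"
proof -
  have Z: "\<sigma> \<subseteq> V" "card \<sigma> = Suc (Suc k)" "finite \<sigma>" if "\<sigma> \<in> Z" for \<sigma>
    using that assms unfolding is_cycle_def by (auto intro: finite_subset)
  have finZ: "finite Z" using assms is_cycle_finite by blast
  have "odd (card {\<sigma> \<in> deletion v Z. \<tau> \<subseteq> \<sigma>}) \<longleftrightarrow> \<tau> \<in> link v Z" if "card \<tau> = Suc k" for \<tau>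
  proof (cases "v \<in> \<tau>")
    case True
    then have "{\<sigma> \<in> deletion v Z. \<tau> \<subseteq> \<sigma>} = {}" unfolding deletion_def by auto
    then show ?thesis using True by (simp add: link_def del: Collect_empty_eq)
  next
    case False
    have "finite \<tau>" using that by (simp add: card_ge_0_finite)
    then have *: "{\<sigma> \<in> Z. \<tau> \<subseteq> \<sigma> \<and> v \<in> \<sigma>} = (if insert v \<tau> \<in> Z then {insert v \<tau>} else {})"
      using False Z that by (intro card_cofaces_vertex) auto
    have "{\<sigma> \<in> Z. \<tau> \<subseteq> \<sigma>} = {\<sigma> \<in> deletion v Z. \<tau> \<subseteq> \<sigma>} \<union> {\<sigma> \<in> Z. \<tau> \<subseteq> \<sigma> \<and> v \<in> \<sigma>}"
      unfolding deletion_def by auto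
    then have "card {\<sigma> \<in> Z. \<tau> \<subseteq> \<sigma>} = card {\<sigma> \<in> deletion v Z. \<tau> \<subseteq> \<sigma>} + card {\<sigma> \<in> Z. \<tau> \<subseteq> \<sigma> \<and> v \<in> \<sigma>}"
      using finZ by (simp add: deletion_def) (subst card_Un_disjoint[symmetric], auto)
    moreover have "even (card {\<sigma> \<in> Z. \<tau> \<subseteq> \<sigma>})"
      using assms(2) that unfolding is_cycle_def boundary_def by auto
    ultimately show ?thesis using * False by (auto simp: link_def split: if_splits)
  qed
  moreover have "card \<tau> = Suc k" if "\<tau> \<in> link v Z" for \<tau>
    using is_cycle_link[OF assms, of v] that unfolding is_cycle_def by auto
  ultimately show ?thesis unfolding boundary_def by blast
qed

text \<open>Faces avoiding \<open>v\<close> arise by dropping the apex, each from one simplex; faces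
  containing \<open>v\<close> are cones over faces of \<open>F\<close>. The two kinds are disjoint,
  so the sum is a plain union.\<close>

lemma boundary_cone:
  assumes F: "\<And>\<sigma>. \<sigma> \<in> F \<Longrightarrow> v \<notin> \<sigma> \<and> card \<sigma> = Suc k" "finite F"
  shows "boundary (Suc k) (insert v ` F) = F \<union> insert v ` boundary k F"
proof -
  have inj: "inj_on (insert v) {\<sigma>. v \<notin> \<sigma>}" by (auto simp: inj_on_def)
  have 1: "odd (card {\<sigma> \<in> insert v ` F. \<tau> \<subseteq> \<sigma>}) \<longleftrightarrow> \<tau> \<in> F" if "card \<tau> = Suc k" "v \<notin> \<tau>" for \<tau>
  proof -
    have "\<tau> = \<sigma>" if "\<sigma> \<in> F" "\<tau> \<subseteq> insert v \<sigma>" for \<sigma>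
    proof (rule card_subset_eq)
      show "finite \<sigma>" using F(1)[OF that(1)] by (simp add: card_ge_0_finite)
    qed (use F(1)[OF that(1)] that \<open>card \<tau> = Suc k\<close> \<open>v \<notin> \<tau>\<close> in auto)
    then have "{\<sigma> \<in> insert v ` F. \<tau> \<subseteq> \<sigma>} = (if \<tau> \<in> F then {insert v \<tau>} else {})"
      by auto
    then show ?thesis by simp
  qed
  have 2: "odd (card {\<sigma> \<in> insert v ` F. \<tau> \<subseteq> \<sigma>}) \<longleftrightarrow> \<tau> - {v} \<in> boundary k F"
    if "card \<tau> = Suc k" "v \<in> \<tau>" for \<tau>
  proof -
    have "{\<sigma> \<in> insert v ` F. \<tau> \<subseteq> \<sigma>} = insert v ` {\<sigma> \<in> F. \<tau> - {v} \<subseteq> \<sigma>}" by auto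
    moreover have "inj_on (insert v) {\<sigma> \<in> F. \<tau> - {v} \<subseteq> \<sigma>}"
      by (rule inj_on_subset[OF inj]) (use F in auto)
    ultimately have "card {\<sigma> \<in> insert v ` F. \<tau> \<subseteq> \<sigma>} = card {\<sigma> \<in> F. \<tau> - {v} \<subseteq> \<sigma>}"
      by (simp add: card_image)
    moreover have "card (\<tau> - {v}) = k" using that by simp
    ultimately show ?thesis unfolding boundary_def by simp
  qed
  have bF: "card \<tau> = k" "v \<notin> \<tau>" "finite \<tau>" if \<tau>: "\<tau> \<in> boundary k F" for \<tau>
  proof -
    have "{\<sigma> \<in> F. \<tau> \<subseteq> \<sigma>} \<noteq> {}" using \<tau> unfolding boundary_def by (auto simp del: Collect_empty_eq dest: odd_pos)
    then obtain \<sigma> where s: "\<sigma> \<in> F" "\<tau> \<subseteq> \<sigma>" by auto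
    then have "finite \<sigma>" "v \<notin> \<sigma>" using F(1)[OF s(1)] by (auto simp: card_ge_0_finite)
    then show "card \<tau> = k" "v \<notin> \<tau>" "finite \<tau>" using \<tau> s finite_subset unfolding boundary_def by auto
  qed
  show ?thesis
  proof (intro set_eqI iffI)
    fix \<tau> assume "\<tau> \<in> boundary (Suc k) (insert v ` F)"
    then have \<tau>: "card \<tau> = Suc k" "odd (card {\<sigma> \<in> insert v ` F. \<tau> \<subseteq> \<sigma>})"
      unfolding boundary_def by auto
    show "\<tau> \<in> F \<union> insert v ` boundary k F"
    proof (cases "v \<in> \<tau>")
      case True
      then have "\<tau> = insert v (\<tau> - {v})" by auto
      then show ?thesis using 2[OF \<tau>(1) True] \<tau>(2) by blast
    qed (use 1 \<tau> in auto)
  next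
    fix \<tau> assume "\<tau> \<in> F \<union> insert v ` boundary k F"
    then show "\<tau> \<in> boundary (Suc k) (insert v ` F)"
    proof
      assume "\<tau> \<in> F"
      then show ?thesis using 1[of \<tau>] F(1)[of \<tau>] unfolding boundary_def by auto
    next
      assume "\<tau> \<in> insert v ` boundary k F"
      then obtain \<rho> where r: "\<rho> \<in> boundary k F" "\<tau> = insert v \<rho>" by auto
      then have "card \<tau> = Suc k" "\<tau> - {v} = \<rho>" using bF[OF r(1)] by auto
      then show ?thesis using 2[of \<tau>] r unfolding boundary_def by auto
    qed
  qed
qed

lemma boundary_vertex_free:
  assumes "\<And>\<sigma>. \<sigma> \<in> G \<Longrightarrow> v \<notin> \<sigma>" "\<tau> \<in> boundary k G"
  shows "v \<notin> \<tau>"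
proof -
  have "{\<sigma> \<in> G. \<tau> \<subseteq> \<sigma>} \<noteq> {}"
    using assms(2) unfolding boundary_def by (auto simp del: Collect_empty_eq dest: odd_pos)
  then show ?thesis using assms(1) by blast
qed

subsection \<open>Cones over cycle bases\<close>

context
  fixes V :: "nat set" and k :: nat and v :: nat and A B :: "nat set set"
  assumes V: "finite V" "v \<in> V"
    and A: "cycle_basis k (V - {v}) A" and B: "cycle_basis (Suc k) (V - {v}) B"
begin

text \<open>The deletion and the filling have the same boundary, namely the link, which cancels in
  their sum.\<close>

lemma residual_is_cycle:
  assumes "is_cycle (Suc k) V Z"
  shows "is_cycle (Suc k) (V - {v}) (sym_diff (deletion v Z) (filling k (link v Z) A))"
proof -
  have fV: "finite (V - {v})" using V by auto
  note F = filling_works[OF A fV is_cycle_link[OF V(1) assms]]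
  have F': "filling k (link v Z) A \<subseteq> {\<sigma>. \<sigma> \<subseteq> V - {v} \<and> card \<sigma> = Suc (Suc k)}"
    using F(1) A unfolding cycle_basis_def by auto
  have D: "deletion v Z \<subseteq> {\<sigma>. \<sigma> \<subseteq> V - {v} \<and> card \<sigma> = Suc (Suc k)}"
    using assms unfolding is_cycle_def deletion_def by auto
  have "boundary (Suc k) (sym_diff (deletion v Z) (filling k (link v Z) A)) = {}"
    using boundary_sym_diff[OF finite_simplex_sets[OF fV D] finite_simplex_sets[OF fV F']]
      F(2) boundary_deletion[OF V(1) assms] by simp
  then show ?thesis using F' D unfolding is_cycle_def by auto
qed

lemma boundary_cone_Un:
  assumes "F \<subseteq> A" "G \<subseteq> B"
  shows "boundary (Suc (Suc k)) (insert v ` F \<union> G) =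
    sym_diff (F \<union> insert v ` boundary (Suc k) F) (boundary (Suc (Suc k)) G)"
proof -
  have fV: "finite (V - {v})" using V by auto
  have F: "v \<notin> \<sigma> \<and> card \<sigma> = Suc (Suc k)" if "\<sigma> \<in> F" for \<sigma>
    using that assms A unfolding cycle_basis_def by auto
  have G: "v \<notin> \<sigma>" if "\<sigma> \<in> G" for \<sigma>
    using that assms B unfolding cycle_basis_def by auto
  have fin: "finite F" "finite G"
    using assms A B finite_simplex_sets[OF fV] unfolding cycle_basis_def by (meson order_trans)+
  have "insert v ` F \<union> G = sym_diff (insert v ` F) G" using G by auto
  then have "boundary (Suc (Suc k)) (insert v ` F \<union> G) = boundary (Suc (Suc k)) (sym_diff (insert v ` F) G)"
    by (rule arg_cong)
  also have "\<dots> = sym_diff (boundary (Suc (Suc k)) (insert v ` F)) (boundary (Suc (Suc k)) G)"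
    using fin by (intro boundary_sym_diff) auto
  also have "boundary (Suc (Suc k)) (insert v ` F) = F \<union> insert v ` boundary (Suc k) F"
    using F fin by (intro boundary_cone) auto
  finally show ?thesis .
qed

lemma boundary_cone_filling:
  assumes Z: "is_cycle (Suc k) V Z"
  defines "F \<equiv> filling k (link v Z) A"
  defines "G \<equiv> filling (Suc k) (sym_diff (deletion v Z) F) B"
  shows "boundary (Suc (Suc k)) (insert v ` F \<union> G) = Z"
proof -
  have fV: "finite (V - {v})" using V by auto
  note F = filling_works[OF A fV is_cycle_link[OF V(1) Z], folded F_def]
  note G = filling_works[OF B fV residual_is_cycle[OF Z, folded F_def], folded G_def]
  have vF: "v \<notin> \<sigma>" if "\<sigma> \<in> F" for \<sigma> using that F A unfolding cycle_basis_def by auto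
  have "Z = deletion v Z \<union> insert v ` link v Z"
  proof -
    have "\<sigma> \<in> insert v ` link v Z" if "\<sigma> \<in> Z" "v \<in> \<sigma>" for \<sigma>
      using that by (intro image_eqI[of _ _ "\<sigma> - {v}"]) (auto simp: link_def insert_absorb)
    then show ?thesis unfolding deletion_def by (auto simp: link_def)
  qed
  moreover have "boundary (Suc (Suc k)) (insert v ` F \<union> G) = 
     sym_diff (F \<union> insert v ` link v Z) (sym_diff (deletion v Z) F)"
    using boundary_cone_Un[OF F(1) G(1)] F(2) G(2) by simp
  moreover have "sym_diff (F \<union> insert v ` link v Z) (sym_diff (deletion v Z) F) = deletion v Z \<union> insert v ` link v Z"
    using vF by (auto simp: deletion_def)
  ultimately show ?thesis by simp
qed

text \<open>Independence is read off at the faces through \<open>v\<close>: they come only from the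
  cone over the boundary of \<open>F\<close>, so \<open>F\<close> is a cycle in \<open>A\<close> and
  vanishes, which leaves a cycle in \<open>B\<close>. Spanning is
  \<open>boundary_cone_filling\<close>.\<close>

lemma cycle_basis_cone: "cycle_basis (Suc k) V (insert v ` A \<union> B)"
  unfolding cycle_basis_def
proof (intro conjI allI impI)
  have fV: "finite (V - {v})" using V by auto
  have vA: "v \<notin> \<sigma>" "finite \<sigma>" "card \<sigma> = Suc (Suc k)" "\<sigma> \<subseteq> V" if "\<sigma> \<in> A" for \<sigma> 
    using that A fV unfolding cycle_basis_def by (auto intro: finite_subset)
  show "insert v ` A \<union> B \<subseteq> {\<sigma>. \<sigma> \<subseteq> V \<and> card \<sigma> = Suc (Suc (Suc k))}"
    using B V vA unfolding cycle_basis_def by fastforce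
  show "H = {}" if "H \<subseteq> insert v ` A \<union> B" "boundary (Suc (Suc k)) H = {}" for H
  proof -
    define F where "F = {\<sigma> \<in> A. insert v \<sigma> \<in> H}"
    define G where "G = H \<inter> B"
    have sub: "F \<subseteq> A" "G \<subseteq> B" unfolding F_def G_def by auto
    have H: "H = insert v ` F \<union> G" using that unfolding F_def G_def by auto
    have vF: "v \<notin> \<sigma>" if "\<sigma> \<in> F" for \<sigma> using that vA F_def by auto
    have vG: "v \<notin> \<sigma>" if "\<sigma> \<in> boundary (Suc (Suc k)) G" for \<sigma>
      by (rule boundary_vertex_free[OF _ that]) (use B sub in \<open>auto simp: cycle_basis_def\<close>)
    have eq: "sym_diff (F \<union> insert v ` boundary (Suc k) F) (boundary (Suc (Suc k)) G) = {}"
      using boundary_cone_Un[OF sub] that H by simp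
    have "boundary (Suc k) F = {}" using eq vG by blast
    then have "F = {}" using A sub unfolding cycle_basis_def by blast
    then have "boundary (Suc (Suc k)) G = {}" using eq by auto
    then have "G = {}" using B sub unfolding cycle_basis_def by blast
    then show "H = {}" using H \<open>F = {}\<close> by simp
  qed
  show "\<exists>H\<subseteq>insert v ` A \<union> B. boundary (Suc (Suc k)) H = Z" if "is_cycle (Suc k) V Z" for Z
    using boundary_cone_filling[OF that] filling_works(1)[OF A fV is_cycle_link[OF V(1) that]]
      filling_works(1)[OF B fV residual_is_cycle[OF that]]
    by (meson Un_mono image_mono)
qed

text \<open>Every simplex of the cone part contains \<open>v\<close> and none of \<open>G\<close>
  does, so nothing cancels and the sizes add. This is the recursion for filling sizes.\<close>

lemma filling_cone:
  assumes Z: "is_cycle (Suc k) V Z"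
  defines "F \<equiv> filling k (link v Z) A"
  defines "G \<equiv> filling (Suc k) (sym_diff (deletion v Z) F) B"
  shows "filling (Suc k) Z (insert v ` A \<union> B) = insert v ` F \<union> G"
    and "card (filling (Suc k) Z (insert v ` A \<union> B)) = card F + card G"
proof -
  have fV: "finite (V - {v})" using V by auto
  note F = filling_works(1)[OF A fV is_cycle_link[OF V(1) Z], folded F_def]
  note G = filling_works(1)[OF B fV residual_is_cycle[OF Z, folded F_def], folded G_def]
  have vF: "v \<notin> \<sigma>" if "\<sigma> \<in> F" for \<sigma> using that F A unfolding cycle_basis_def by auto
  have vG: "v \<notin> \<sigma>" if "\<sigma> \<in> G" for \<sigma> using that G B unfolding cycle_basis_def by auto
  have fin: "finite F" "finite G"
    using F G A B finite_simplex_sets[OF fV] unfolding cycle_basis_def by (meson order_trans)+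
  show *: "filling (Suc k) Z (insert v ` A \<union> B) = insert v ` F \<union> G"
    using boundary_cone_filling[OF Z] F G unfolding F_def G_def
    by (intro filling_eqI[OF cycle_basis_cone V(1)]) auto
  have "card (insert v ` F) = card F"
    by (rule card_image, rule inj_onI) (use vF in \<open>metis insert_ident\<close>)
  moreover have "insert v ` F \<inter> G = {}" using vG by auto
  ultimately show "card (filling (Suc k) Z (insert v ` A \<union> B)) = card F + card G"
    using fin by (simp add: * card_Un_disjoint)
qed

end

section \<open>Supports of cycles\<close>

text \<open>If all simplices of \<open>Z\<close> at \<open>u\<close> contained \<open>v\<close>,
  then for one of them, \<sigma>, the face \<open>\<sigma> - {v}\<close>, which still contains
  \<open>u\<close>, would have \<sigma> as its only coface in \<open>Z\<close>, an odd
  number.\<close>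

lemma support_deletion:
  assumes "finite V" "is_cycle (Suc k) V Z"
  shows "\<Union>(deletion v Z) = \<Union>Z - {v}"
proof
  show "\<Union>(deletion v Z) \<subseteq> \<Union>Z - {v}" by (auto simp: deletion_def)
  have simplex: "\<rho> \<subseteq> V \<and> card \<rho> = Suc (Suc k)" if "\<rho> \<in> Z" for \<rho>
    using assms(2) that unfolding is_cycle_def by blast
  show "\<Union>Z - {v} \<subseteq> \<Union>(deletion v Z)"
  proof
    fix u assume "u \<in> \<Union>Z - {v}"
    then obtain \<sigma> where s: "\<sigma> \<in> Z" "u \<in> \<sigma>" "u \<noteq> v" by auto
    show "u \<in> \<Union>(deletion v Z)"
    proof (cases "v \<in> \<sigma>")
      case True
      have "card (\<sigma> - {v}) = Suc k" using assms(2) s True unfolding is_cycle_def by auto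
      then have "even (card {\<rho> \<in> Z. \<sigma> - {v} \<subseteq> \<rho>})"
        using assms(2) unfolding is_cycle_def boundary_def by auto
      moreover have "{\<rho> \<in> Z. \<sigma> - {v} \<subseteq> \<rho>} = {\<sigma>}" if "u \<notin> \<Union>(deletion v Z)"
      proof -
        have "\<rho> = \<sigma>" if \<rho>: "\<rho> \<in> Z" "\<sigma> - {v} \<subseteq> \<rho>" for \<rho>
        proof -
          have "v \<in> \<rho>" using \<rho> s \<open>u \<notin> \<Union>(deletion v Z)\<close> unfolding deletion_def by auto
          then have "\<sigma> \<subseteq> \<rho>" using \<rho> by auto
          moreover have "finite \<rho>" "card \<rho> = card \<sigma>"
            using simplex \<rho> s assms(1) by (auto intro: finite_subset)
          ultimately show ?thesis using card_subset_eq by metis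
        qed
        then have "{\<rho> \<in> Z. \<sigma> - {v} \<subseteq> \<rho>} \<subseteq> {\<sigma>}" by (intro subsetI) simp
        then show ?thesis using s(1) by (intro equalityI) simp_all
      qed
      ultimately show ?thesis by force
    qed (use s in \<open>auto simp: deletion_def\<close>)
  qed
qed

text \<open>A nonzero cycle supported on one simplex would consist of that simplex alone; deleting a
  vertex would empty it, although \<open>support_deletion\<close> keeps the other vertices.\<close>

lemma card_support_cycle:
  assumes "finite V" "is_cycle (Suc k) V Z" "Z \<noteq> {}"
  shows "k + 3 \<le> card (\<Union>Z)"
proof -
  obtain \<sigma> where s: "\<sigma> \<in> Z" using assms by auto
  then have card: "card \<sigma> = k + 2" using assms unfolding is_cycle_def by auto
  have fin: "finite (\<Union>Z)" using finite_subset[OF is_cycle_support[OF assms(2)] assms(1)] .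
  have "card \<sigma> \<noteq> card (\<Union>Z)"
  proof
    assume "card \<sigma> = card (\<Union>Z)"
    then have eq: "\<sigma> = \<Union>Z" using card_subset_eq[OF fin, of \<sigma>] s by auto
    obtain v where v: "v \<in> \<sigma>" using card by fastforce
    have "Z = {\<sigma>}"
    proof -
      have "\<rho> = \<sigma>" if "\<rho> \<in> Z" for \<rho>
      proof (rule card_subset_eq)
        show "finite \<sigma>" using eq fin by simp
      qed (use that eq card assms in \<open>auto simp: is_cycle_def\<close>)
      then have "Z \<subseteq> {\<sigma>}" by (intro subsetI) simp
      then show ?thesis using s by (intro equalityI) simp_all
    qed
    then have "\<Union>(deletion v Z) = {}" using v by (auto simp: deletion_def)
    then have "\<sigma> \<subseteq> {v}" using support_deletion[OF assms(1,2), of v] eq by auto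
    then have "card \<sigma> \<le> 1" using card_mono[of "{v}" \<sigma>] by simp
    then show False using card by simp
  qed
  moreover have "card \<sigma> \<le> card (\<Union>Z)" using fin s by (intro card_mono) auto
  ultimately show ?thesis using card by simp
qed

subsection \<open>Random cycle bases\<close>

abbreviation expect :: "'a pmf \<Rightarrow> ('a \<Rightarrow> real) \<Rightarrow> real" where
  "expect p f \<equiv> measure_pmf.expectation p f"

lemma expect_mono:
  assumes "finite (set_pmf p)" "\<And>x. x \<in> set_pmf p \<Longrightarrow> f x \<le> g x"
  shows "expect p f \<le> expect p g"
  using assms by (intro integral_mono_AE) (auto simp: integrable_measure_pmf_finite AE_measure_pmf_iff)

lemma expect_cong:
  assumes "\<And>x. x \<in> set_pmf p \<Longrightarrow> f x = g x"
  shows "expect p f = expect p g"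
  using assms by (intro integral_cong_AE) (auto simp: AE_measure_pmf_iff)

lemma expect_add:
  assumes "finite (set_pmf p)"
  shows "expect p (\<lambda>x. f x + g x) = expect p f + expect p g"
  using assms by (simp add: integrable_measure_pmf_finite)

lemma expect_attained:
  assumes "finite (set_pmf p)"
  shows "\<exists>x\<in>set_pmf p. expect p f \<le> f x"
proof (rule ccontr)
  define m where "m = Max (f ` set_pmf p)"
  assume "\<not> ?thesis"
  then have "m < expect p f"
    using Max_in[of "f ` set_pmf p"] assms set_pmf_not_empty[of p] unfolding m_def by auto
  moreover have "expect p f \<le> expect p (\<lambda>_. m)"
    using assms unfolding m_def by (intro expect_mono) auto
  ultimately show False by simp
qed

text \<open>
  The lower bounds are required for all nonzero cycles, not just for boundaries of simplices: the
  links met when filling a cycle one dimension higher are arbitrary.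
\<close>

definition spread :: "nat \<Rightarrow> real \<Rightarrow> nat set \<Rightarrow> nat set set pmf \<Rightarrow> bool" where
  "spread k b V p \<longleftrightarrow>
     (\<forall>T\<in>set_pmf p. cycle_basis k V T) \<and>
     (\<forall>\<tau>\<subseteq>V. card \<tau> = k + 2 \<longrightarrow> real (card V) * expect p (\<lambda>T. of_bool (\<tau> \<in> T)) \<le> k + 2) \<and>
     (\<forall>L. is_cycle k V L \<and> L \<noteq> {} \<longrightarrow>
        b * real ((card V - 1) choose (k + 1)) \<le> expect p (\<lambda>T. real (card (filling k L T))) \<and>
        b * real (card V) \<le> expect p (\<lambda>T. real (card (\<Union>(filling k L T)))))"

lemma cycle_basis_simplex:
  assumes "cycle_basis k V T" "\<sigma> \<in> T"
  shows "\<sigma> \<subseteq> V" "card \<sigma> = Suc (Suc k)"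
proof -
  have "T \<subseteq> {\<sigma>. \<sigma> \<subseteq> V \<and> card \<sigma> = Suc (Suc k)}"
    using assms(1) unfolding cycle_basis_def by (rule conjunct1)
  then show "\<sigma> \<subseteq> V" "card \<sigma> = Suc (Suc k)" using assms(2) by auto
qed

lemma finite_cycle_bases:
  assumes "finite V" "\<forall>T\<in>set_pmf p. cycle_basis k V T"
  shows "finite (set_pmf p)"
proof (rule finite_subset)
  show "set_pmf p \<subseteq> Pow (Pow V)"
  proof
    fix T assume "T \<in> set_pmf p"
    then have "cycle_basis k V T" using assms(2) by simp
    then show "T \<in> Pow (Pow V)" using cycle_basis_simplex(1) by blast
  qed
qed (use assms(1) in simp)

text \<open>Given \<open>v\<close>, the bases \<open>A\<close> and \<open>B\<close> are independent.
  The residual cycle depends on \<open>A\<close> only, so expected bounds for fillings in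
  \<open>B\<close> apply to it as to a fixed cycle.\<close>

definition cone_pmf ::
  "nat set \<Rightarrow> (nat \<Rightarrow> nat set set pmf) \<Rightarrow> (nat \<Rightarrow> nat set set pmf) \<Rightarrow> nat set set pmf" where
  "cone_pmf V P Q =
     pmf_of_set V \<bind> (\<lambda>v. P v \<bind> (\<lambda>A. map_pmf (\<lambda>B. insert v ` A \<union> B) (Q v)))"

lemma set_cone_pmf:
  assumes "finite V" "V \<noteq> {}"
  shows "set_pmf (cone_pmf V P Q) =
    (\<Union>v\<in>V. \<Union>A\<in>set_pmf (P v). (\<lambda>B. insert v ` A \<union> B) ` set_pmf (Q v))"
  using assms unfolding cone_pmf_def by simp

lemma expect_bind:
  assumes "finite (set_pmf p)" "\<And>x. x \<in> set_pmf p \<Longrightarrow> finite (set_pmf (f x))"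
  shows "expect (p \<bind> f) h = expect p (\<lambda>x. expect (f x) h)"
  using assms by (simp add: pmf_expectation_bind[of "set_pmf p"] integral_measure_pmf[of "set_pmf p"])

lemma expect_cone_pmf:
  assumes "finite V" "V \<noteq> {}"
    and "\<And>v. v \<in> V \<Longrightarrow> finite (set_pmf (P v))"
    and "\<And>v. v \<in> V \<Longrightarrow> finite (set_pmf (Q v))"
  shows "expect (cone_pmf V P Q) h =
    (\<Sum>v\<in>V. expect (P v) (\<lambda>A. expect (Q v) (\<lambda>B. h (insert v ` A \<union> B)))) / real (card V)"
  unfolding cone_pmf_def using assms
  by (subst pmf_expectation_bind_pmf_of_set)
    (auto simp: expect_bind divide_inverse sum_distrib_left mult.commute intro!: sum.cong)

section \<open>Elimination of a fixed vertex\<close>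

context
  fixes V :: "nat set" and k :: nat and v :: nat and p q :: "nat set set pmf" and b :: real
  assumes V: "finite V" "v \<in> V"
    and b: "0 \<le> b"
    and p: "spread k b (V - {v}) p"
    and q: "\<forall>B\<in>set_pmf q. cycle_basis (Suc k) (V - {v}) B"
begin

lemma p_basis: "A \<in> set_pmf p \<Longrightarrow> cycle_basis k (V - {v}) A"
  using p unfolding spread_def by auto

lemma finite_p: "finite (set_pmf p)"
  using p V finite_cycle_bases[of "V - {v}" p k] unfolding spread_def by auto

lemma finite_q: "finite (set_pmf q)"
  using q V finite_cycle_bases[of "V - {v}" q "Suc k"] by auto

lemma filling_cone_miss:
  assumes "is_cycle (Suc k) V Z" "v \<notin> \<Union>Z" "A \<in> set_pmf p" "B \<in> set_pmf q"
  shows "filling (Suc k) Z (insert v ` A \<union> B) = filling (Suc k) Z B"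
proof -
  have "link v Z = {}" "deletion v Z = Z" using assms by (auto simp: link_def deletion_def)
  moreover have "filling k {} A = {}"
    using filling_empty[OF p_basis] assms V by auto
  ultimately show ?thesis
    using filling_cone(1)[OF V p_basis q[rule_format] assms(1)] assms by auto
qed

text \<open>
  A vertex of \<open>deletion v Z\<close> can only disappear from the residual cycle if a fixed simplex \<open>\<tau> u\<close> at it
  belongs to \<open>A\<close>, while vertices of the filling outside \<open>deletion v Z\<close> cannot disappear at all.
\<close>

lemma expect_support_residual:
  assumes Z: "is_cycle (Suc k) V Z" and v: "v \<in> \<Union>Z"
  defines "R \<equiv> \<lambda>A. sym_diff (deletion v Z) (filling k (link v Z) A)"
  shows "(real (card (\<Union>Z)) - 1) * (1 - real (k + 2) / real (card V - 1))
      \<le> expect p (\<lambda>A. real (card (\<Union>(R A))))"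
    and "2 * (k + 2) \<le> card V - 1 \<Longrightarrow> b * real (card V - 1) / 2 \<le> expect p (\<lambda>A. real (card (\<Union>(R A))))"
proof -
  define U where "U = \<Union>Z - {v}"
  define F where "F = filling k (link v Z)"
  have SV: "\<Union>Z \<subseteq> V" using is_cycle_support[OF Z] .
  have cardW: "card (V - {v}) = card V - 1" using V by simp
  have finU: "finite U" unfolding U_def using SV V finite_subset by auto
  have finF: "F A \<subseteq> A" "\<Union>(F A) \<subseteq> V - {v}" if "A \<in> set_pmf p" for A
    using filling_works(1)[OF p_basis[OF that] _ is_cycle_link[OF V(1) Z]] V p_basis[OF that]
    unfolding F_def cycle_basis_def by auto
  have "\<forall>u\<in>U. \<exists>\<tau>\<in>deletion v Z. u \<in> \<tau>"
    using support_deletion[OF V(1) Z, of v] unfolding U_def by blast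
  then obtain \<tau> where \<tau>: "\<And>u. u \<in> U \<Longrightarrow> \<tau> u \<in> deletion v Z \<and> u \<in> \<tau> u" by metis
  have "0 < card (\<Union>Z)" using v finite_subset[OF SV V(1)] card_gt_0_iff by blast
  then have U1: "real (card U) = real (card (\<Union>Z)) - 1"
    unfolding U_def using v by (simp add: of_nat_diff)
  have Z2: "Z \<noteq> {}" using v by auto
  have "k + 3 \<le> card V" using card_support_cycle[OF V(1) Z Z2] card_mono[OF V(1) SV] by linarith
  then have n1: "real (card V - 1) > 0" by simp
  have pr: "expect p (\<lambda>A. of_bool (\<tau> u \<in> A)) \<le> real (k + 2) / real (card V - 1)" if "u \<in> U" for u
  proof -
    have "\<tau> u \<subseteq> V - {v}" "card (\<tau> u) = k + 2"
      using \<tau>[OF that] Z unfolding deletion_def is_cycle_def by auto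
    then have "real (card V - 1) * expect p (\<lambda>A. of_bool (\<tau> u \<in> A)) \<le> real (k + 2)"
      using p cardW unfolding spread_def by metis
    then show ?thesis using n1 by (simp add: field_simps)
  qed
  have pointwise: "(\<Sum>u\<in>U. 1 - of_bool (\<tau> u \<in> A)) + real (card (\<Union>(F A) - U)) \<le> real (card (\<Union>(R A)))"
    if A: "A \<in> set_pmf p" for A
  proof -
    define U' where "U' = {u \<in> U. \<tau> u \<notin> A}"
    have "U' \<subseteq> \<Union>(R A)"
      using \<tau> finF(1)[OF A] unfolding U'_def R_def F_def by blast
    moreover have "\<Union>(F A) - U \<subseteq> \<Union>(R A)"
    proof
      fix u assume u: "u \<in> \<Union>(F A) - U"
      then obtain \<rho> where r: "\<rho> \<in> F A" "u \<in> \<rho>" by auto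
      have "\<rho> \<notin> deletion v Z" 
        using r u support_deletion[OF V(1) Z, of v] unfolding U_def by blast
      then show "u \<in> \<Union>(R A)" using r unfolding R_def F_def by auto
    qed
    moreover have "finite (\<Union>(R A))"
      by (rule finite_subset[of _ V])
        (use finF(2)[OF A] SV V in \<open>auto simp: R_def deletion_def F_def\<close>)
    ultimately have "card (U' \<union> (\<Union>(F A) - U)) \<le> card (\<Union>(R A))"
      by (intro card_mono) auto
    moreover have "card (U' \<union> (\<Union>(F A) - U)) = card U' + card (\<Union>(F A) - U)"
      using finU finF(2)[OF A] V finite_subset[of "\<Union>(F A)" V]
      by (intro card_Un_disjoint) (auto simp: U'_def)
    moreover have "(\<Sum>u\<in>U. 1 - of_bool (\<tau> u \<in> A)) = real (card U')"
    proof -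
      have "(\<Sum>u\<in>U. 1 - of_bool (\<tau> u \<in> A)) = (\<Sum>u\<in>U. of_bool (\<tau> u \<notin> A) :: real)"
        by (intro sum.cong) auto
      also have "\<dots> = real (card U')" using finU by (simp add: U'_def Int_def)
      finally show ?thesis .
    qed
    ultimately show ?thesis by linarith
  qed
  define e where "e = expect p (\<lambda>A. real (card (\<Union>(F A) - U)))"
  have e0: "0 \<le> e" unfolding e_def by simp
  have main: "(\<Sum>u\<in>U. 1 - expect p (\<lambda>A. of_bool (\<tau> u \<in> A))) + e \<le> expect p (\<lambda>A. real (card (\<Union>(R A))))"
  proof -
    have "(\<Sum>u\<in>U. 1 - expect p (\<lambda>A. of_bool (\<tau> u \<in> A))) + e
      = expect p (\<lambda>A. (\<Sum>u\<in>U. 1 - of_bool (\<tau> u \<in> A)) + real (card (\<Union>(F A) - U)))"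
      using finite_p unfolding e_def
      by (subst expect_add) (auto simp: integrable_measure_pmf_finite)
    also have "\<dots> \<le> expect p (\<lambda>A. real (card (\<Union>(R A))))"
      using finite_p pointwise by (intro expect_mono)
    finally show ?thesis .
  qed
  have "real (card U) * (1 - real (k + 2) / real (card V - 1)) \<le> (\<Sum>u\<in>U. 1 - expect p (\<lambda>A. of_bool (\<tau> u \<in> A)))"
    using pr by (intro sum_bounded_below) auto
  then have low: "real (card U) * (1 - real (k + 2) / real (card V - 1)) + e \<le> expect p (\<lambda>A. real (card (\<Union>(R A))))"
    using main by linarith
  then show "(real (card (\<Union>Z)) - 1) * (1 - real (k + 2) / real (card V - 1))
      \<le> expect p (\<lambda>A. real (card (\<Union>(R A))))"
    using e0 U1 by simp
  \<comment> \<open>The loss probability is now at most 1/2, so half of \<open>U\<close> survives in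
    expectation, and all vertices outside \<open>U\<close> do. Together these sets cover the support
    of the filling of the link, so half of its bound remains.\<close>
  assume big: "2 * (k + 2) \<le> card V - 1"
  have "real (2 * (k + 2)) \<le> real (card V - 1)" using big by (rule of_nat_mono)
  then have "real (k + 2) / real (card V - 1) \<le> 1/2" using n1 by (simp add: field_simps)
  then have "real (card U) * (1/2) \<le> real (card U) * (1 - real (k + 2) / real (card V - 1))"
    by (intro mult_left_mono) auto
  moreover have "b * real (card V - 1) \<le> real (card U) + e"
  proof -
    have "b * real (card V - 1) \<le> expect p (\<lambda>A. real (card (\<Union>(F A))))"
      using p is_cycle_link[OF V(1) Z, of v] link_nonempty[OF v] cardW
      unfolding spread_def F_def by metis
    also have "\<dots> \<le> expect p (\<lambda>A. real (card U) + real (card (\<Union>(F A) - U)))"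
    proof (rule expect_mono[OF finite_p])
      fix A assume A: "A \<in> set_pmf p"
      have "card (\<Union>(F A)) \<le> card (U \<union> (\<Union>(F A) - U))"
        using finU finF(2)[OF A] V finite_subset[of "\<Union>(F A)" V] by (intro card_mono) auto
      also have "\<dots> \<le> card U + card (\<Union>(F A) - U)" by (rule card_Un_le)
      finally show "real (card (\<Union>(F A))) \<le> real (card U) + real (card (\<Union>(F A) - U))" by linarith
    qed
    also have "\<dots> = real (card U) + e" using finite_p by (simp add: expect_add e_def)
    finally show ?thesis .
  qed
  ultimately show "b * real (card V - 1) / 2 \<le> expect p (\<lambda>A. real (card (\<Union>(R A))))"
    using low e0 by linarith
qed

text \<open>The link is a nonzero cycle on \<open>card V - 1\<close> vertices, hence the binomial
  with \<open>card V - 2\<close>. The factor \<open>c\<close> is left open;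
  \<open>fills_support\<close> on \<open>V - {v}\<close> will provide it.\<close>

lemma expect_filling_hit:
  assumes Z: "is_cycle (Suc k) V Z" and v: "v \<in> \<Union>Z"
    and ih: "\<And>Y. is_cycle (Suc k) (V - {v}) Y \<Longrightarrow>
      c * real (card (\<Union>Y)) \<le> expect q (\<lambda>B. real (card (filling (Suc k) Y B)))"
  shows "b * real ((card V - 2) choose (k + 1)) +
      c * expect p (\<lambda>A. real (card (\<Union>(sym_diff (deletion v Z) (filling k (link v Z) A)))))
    \<le> expect p (\<lambda>A. expect q (\<lambda>B. real (card (filling (Suc k) Z (insert v ` A \<union> B)))))"
proof -
  define R where "R = (\<lambda>A. sym_diff (deletion v Z) (filling k (link v Z) A))"
  have "b * real ((card V - 2) choose (k + 1)) \<le> expect p (\<lambda>A. real (card (filling k (link v Z) A)))"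
  proof -
    have "card (V - {v}) - 1 = card V - 2" using V by simp
    then show ?thesis
      using p is_cycle_link[OF V(1) Z, of v] link_nonempty[OF v] unfolding spread_def by metis
  qed
  then have "b * real ((card V - 2) choose (k + 1)) + c * expect p (\<lambda>A. real (card (\<Union>(R A))))
    \<le> expect p (\<lambda>A. real (card (filling k (link v Z) A)) + c * real (card (\<Union>(R A))))"
    using finite_p by (simp add: expect_add)
  also have "\<dots> \<le> expect p (\<lambda>A. expect q (\<lambda>B. real (card (filling (Suc k) Z (insert v ` A \<union> B)))))"
  proof (rule expect_mono[OF finite_p])
    fix A assume A: "A \<in> set_pmf p"
    have "expect q (\<lambda>B. real (card (filling (Suc k) Z (insert v ` A \<union> B))))
      = expect q (\<lambda>B. real (card (filling k (link v Z) A)) + real (card (filling (Suc k) (R A) B)))"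
      using filling_cone(2)[OF V p_basis[OF A] q[rule_format] Z] unfolding R_def
      by (intro expect_cong) auto
    also have "\<dots> = real (card (filling k (link v Z) A)) + expect q (\<lambda>B. real (card (filling (Suc k) (R A) B)))"
      using finite_q by (simp add: expect_add)
    finally have eq: "expect q (\<lambda>B. real (card (filling (Suc k) Z (insert v ` A \<union> B)))) = \<dots>" .
    show "real (card (filling k (link v Z) A)) + c * real (card (\<Union>(R A)))
      \<le> expect q (\<lambda>B. real (card (filling (Suc k) Z (insert v ` A \<union> B))))"
    proof -
      obtain B where "B \<in> set_pmf q" using set_pmf_not_empty[of q] by auto
      then have "is_cycle (Suc k) (V - {v}) (R A)"
        unfolding R_def using residual_is_cycle[OF V p_basis[OF A] q[rule_format] Z] by blast
      then show ?thesis unfolding eq using ih by (intro add_left_mono)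
    qed
  qed
  finally show ?thesis unfolding R_def .
qed

lemma expect_support_hit:
  assumes Z: "is_cycle (Suc k) V Z" and v: "v \<in> \<Union>Z" and "b \<le> 1"
  shows "b * real (card V) \<le>
    expect p (\<lambda>A. expect q (\<lambda>B. real (card (\<Union>(filling (Suc k) Z (insert v ` A \<union> B))))))"
proof -
  have n0: "0 < card V" using V by (auto simp: card_gt_0_iff)
  \<comment> \<open>The apex \<open>v\<close> contributes one vertex to the support, which makes up
    for the loss of \<open>b \<le> 1\<close> in passing to \<open>V - {v}\<close>.\<close>
  have nn: "b * real (card V) \<le> b * real (card (V - {v})) + 1" 
    using V \<open>b \<le> 1\<close> n0 by (simp add: of_nat_diff algebra_simps)
  have "b * real (card (V - {v})) \<le> expect p (\<lambda>A. real (card (\<Union>(filling k (link v Z) A))))"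
    using p is_cycle_link[OF V(1) Z, of v] link_nonempty[OF v] unfolding spread_def by metis
  then have "b * real (card V) \<le> expect p (\<lambda>A. real (card (\<Union>(filling k (link v Z) A))) + 1)"
    using nn finite_p by (simp add: expect_add)
  also have "\<dots> \<le> expect p (\<lambda>A. expect q (\<lambda>B. real (card (\<Union>(filling (Suc k) Z (insert v ` A \<union> B))))))"
  proof (rule expect_mono[OF finite_p])
    fix A assume A: "A \<in> set_pmf p"
    define F where "F = filling k (link v Z) A"
    have F: "F \<subseteq> A" "boundary (Suc k) F = link v Z"
      using filling_works[OF p_basis[OF A] _ is_cycle_link[OF V(1) Z]] V unfolding F_def by auto
    have "F \<noteq> {}" using F(2) link_nonempty[OF v] by auto
    have FV: "\<Union>F \<subseteq> V - {v}" using F p_basis[OF A] unfolding cycle_basis_def by auto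
    have "real (card (\<Union>F)) + 1 \<le> real (card (\<Union>(filling (Suc k) Z (insert v ` A \<union> B))))"
      if B: "B \<in> set_pmf q" for B
    proof -
      have "insert v (\<Union>F) \<subseteq> \<Union>(filling (Suc k) Z (insert v ` A \<union> B))"
        using filling_cone(1)[OF V p_basis[OF A] q[rule_format, OF B] Z, folded F_def] \<open>F \<noteq> {}\<close> by auto
      moreover have "\<Union>(filling (Suc k) Z (insert v ` A \<union> B)) \<subseteq> V"
      proof -
        note basis = cycle_basis_cone[OF V p_basis[OF A] q[rule_format, OF B]]
        have "insert v ` A \<union> B \<subseteq> Pow V"
          using basis unfolding cycle_basis_def
          by (elim conjE) (erule order_trans, simp add: Collect_mono_iff Pow_def)
        then have "filling (Suc k) Z (insert v ` A \<union> B) \<subseteq> Pow V"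
          using filling_works(1)[OF basis V(1) Z] by (rule order_trans[rotated])
        then show ?thesis by (meson Union_least PowD subsetD)
      qed
      ultimately have "card (insert v (\<Union>F)) \<le> card (\<Union>(filling (Suc k) Z (insert v ` A \<union> B)))"
        using V finite_subset by (intro card_mono) auto
      moreover have "card (insert v (\<Union>F)) = card (\<Union>F) + 1"
        using FV V finite_subset[of "\<Union>F" "V - {v}"] by (subst card_insert_disjoint) auto
      ultimately show ?thesis by linarith
    qed
    then have "expect q (\<lambda>_. real (card (\<Union>F)) + 1) \<le>
      expect q (\<lambda>B. real (card (\<Union>(filling (Suc k) Z (insert v ` A \<union> B)))))"
      by (intro expect_mono finite_q)
    then show "real (card (\<Union>(filling k (link v Z) A))) + 1 \<le>
      expect q (\<lambda>B. real (card (\<Union>(filling (Suc k) Z (insert v ` A \<union> B)))))"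
      unfolding F_def by simp
  qed
  finally show ?thesis .
qed

end

subsection \<open>Raising the dimension\<close>

lemma times_binomial_Suc: "Suc j * (m choose Suc j) = (m - j) * (m choose j)"
  by (cases m) (simp_all only: Suc_times_binomial binomial_absorb_comp diff_Suc_1 binomial_0_Suc mult_0_right mult_0 diff_0_eq_0)

lemma sum_subset_lower_bound:
  fixes X :: "'a \<Rightarrow> real"
  assumes "finite V" "S \<subseteq> V" "\<And>v. v \<in> S \<Longrightarrow> h \<le> X v" "\<And>v. v \<in> V - S \<Longrightarrow> m \<le> X v"
  shows "real (card S) * h + (real (card V) - real (card S)) * m \<le> sum X V"
proof -
  have "real (card S) * h \<le> sum X S"
    using assms by (intro sum_bounded_below) auto
  moreover have "real (card (V - S)) * m \<le> sum X (V - S)"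
    using assms by (intro sum_bounded_below) auto
  moreover have "real (card (V - S)) = real (card V) - real (card S)"
    using assms card_mono[of V S] finite_subset[of S V] by (simp add: card_Diff_subset of_nat_diff)
  moreover have "sum X V = sum X (V - S) + sum X S"
    using assms by (intro sum.subset_diff)
  ultimately show ?thesis by simp
qed

lemma spread_member:
  assumes "spread k b V p" "\<tau> \<subseteq> V" "card \<tau> = k + 2"
  shows "real (card V) * expect p (\<lambda>T. of_bool (\<tau> \<in> T)) \<le> real (k + 2)"
  using assms unfolding spread_def by (elim conjE allE[of _ \<tau>] impE) simp_all

text \<open>
  Up to the binomial factor the bound is linear in the fraction of vertices supporting the cycle. That
  fraction decreases only slightly in expectation when a random vertex is eliminated, which is what
  allows the induction on the number of vertices.
\<close>

definition fills_support :: "nat \<Rightarrow> real \<Rightarrow> nat set \<Rightarrow> nat set set pmf \<Rightarrow> bool" where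
  "fills_support k b V q \<longleftrightarrow> (\<forall>Z. is_cycle (Suc k) V Z \<longrightarrow>
     b / 2 * (real (card (\<Union>Z)) / real (card V)) * real ((card V - 1) choose (k + 2))
       \<le> expect q (\<lambda>T. real (card (filling (Suc k) Z T))))"

section \<open>Inequalities for averaging over hits and misses\<close>

text \<open>Here \<open>n\<close> and \<open>s\<close> count the vertices of \<open>V\<close> and of
  the cycle, \<open>c1\<close> and \<open>c2\<close> are the binomials of \<open>n - 2\<close> over
  \<open>k + 1\<close> and \<open>k + 2\<close>, and \<open>e\<close> stands for the support of the
  residual cycle. A hit yields \<open>b * c1\<close> where the target asks for
  \<open>b / 2 * c1\<close>; this surplus pays for the vertices lost by the residual cycle.\<close>

lemma residual_arith:
  fixes b n s c1 c2 k e :: real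
  assumes "0 \<le> b" "1 < n" "1 \<le> s" "s \<le> n" "0 \<le> c1" "0 \<le> c2" "k + 3 \<le> n" "0 \<le> k"
    and c: "(k + 2) * c2 = (n - k - 3) * c1"
    and e: "(s - 1) * (1 - (k + 2) / (n - 1)) \<le> e"
  shows "b / 2 * (s / n) * (c1 + c2) \<le>
    (s * (b * c1 + b / 2 / (n - 1) * c2 * e) + (n - s) * (b / 2 * (s / (n - 1)) * c2)) / n"
proof -
  define w where "w = c2 / (n - 1)"
  have w: "0 \<le> w" "c2 = w * (n - 1)" using assms by (simp_all add: w_def)
  have "(k + 2) * w = (n - k - 3) / (n - 1) * c1" using c assms by (simp add: w_def)
  also have "\<dots> \<le> 1 * c1" using assms by (intro mult_right_mono) simp_all
  finally have kw: "(k + 2) * w \<le> c1" by simp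
  have "(s - 1) / (n - 1) * ((k + 2) * w) \<le> 1 * c1"
    using assms kw w(1) by (intro mult_mono) simp_all
  moreover have "w * ((s - 1) * (1 - (k + 2) / (n - 1))) \<le> w * e"
    using e w(1) by (rule mult_left_mono)
  moreover have "w * ((s - 1) * (1 - (k + 2) / (n - 1))) = w * (s - 1) - (s - 1) / (n - 1) * ((k + 2) * w)"
    by (simp add: algebra_simps add_divide_distrib diff_divide_distrib)
  ultimately have "c1 + c2 \<le> 2 * c1 + w * e + (n - s) * w"
    using w(2) by (simp add: algebra_simps)
  then have "b * s / 2 * (c1 + c2) \<le> b * s / 2 * (2 * c1 + w * e + (n - s) * w)"
    using assms by (intro mult_left_mono) simp_all
  also have "\<dots> = s * (b * c1 + b / 2 / (n - 1) * c2 * e) + (n - s) * (b / 2 * (s / (n - 1)) * c2)"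
    by (simp add: w_def algebra_simps add_divide_distrib diff_divide_distrib)
  finally have "b * s / 2 * (c1 + c2) / n \<le> \<dots> / n"
    using assms by (intro divide_right_mono) simp_all
  then show ?thesis by simp
qed

text \<open>\<open>h\<close> is the gain at a hit; let \<open>g = b^2 / 8\<close>. For large
  \<open>n\<close> a hit yields \<open>2 * g * c2\<close> against a target of \<open>g * c2\<close>,
  and the surplus \<open>s * g * c2\<close> supplies most of \<open>n * g * c1\<close> through
  \<open>k + 2 \<le> s\<close> and the ratio of \<open>c1\<close> to \<open>c2\<close>. For small
  \<open>n\<close> one has \<open>c2 \<le> c1\<close> and \<open>n \<le> 2 * s\<close>, and
  \<open>b * c1\<close> alone suffices.\<close>

lemma filling_arith:
  fixes b n s c1 c2 k h :: real
  assumes "0 \<le> b" "b \<le> 1" "0 < n" "k + 3 \<le> s" "s \<le> n" "0 \<le> c1" "0 \<le> c2" "0 \<le> k"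
    and c: "(k + 2) * c2 = (n - k - 3) * c1"
    and h: "b * c1 \<le> h" "2 * (k + 2) \<le> n - 1 \<Longrightarrow> b * c1 + b^2 / 4 * c2 \<le> h"
    and nk: "2 * (k + 2) \<le> n - 1 \<or> n \<le> 2 * (k + 2)"
  shows "b^2 / 8 * (c1 + c2) \<le> (s * h + (n - s) * (b^2 / 8 * c2)) / n"
proof -
  define g where "g = b^2 / 8"
  have "b * b \<le> 1 * b" using assms by (intro mult_right_mono)
  then have g: "0 \<le> g" "8 * g \<le> b" by (simp_all add: g_def power2_eq_square)
  have "n * (g * (c1 + c2)) \<le> s * h + (n - s) * (g * c2)"
  proof (cases "2 * (k + 2) \<le> n - 1")
    case True
    have "(k + 2) * c2 \<le> s * c2" using assms by (intro mult_right_mono) simp_all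
    then have "g * ((n - k - 3) * c1) \<le> g * (s * c2)" using g c by (intro mult_left_mono) simp_all
    moreover have "(k + 3) * (g * c1) \<le> s * (b * c1)"
      using assms g by (intro mult_mono) simp_all
    moreover have "s * (b * c1 + 2 * g * c2) \<le> s * h"
      using h(2)[OF True] assms by (intro mult_left_mono) (simp_all add: g_def)
    ultimately show ?thesis by (simp add: algebra_simps)
  next
    case False
    then have n: "n \<le> 2 * (k + 2)" using nk by simp
    then have "(n - k - 3) * c1 \<le> (k + 2) * c1" using assms by (intro mult_right_mono) simp_all
    then have "(k + 2) * c2 \<le> (k + 2) * c1" using c by simp
    then have "c2 \<le> c1" by (rule mult_left_le_imp_le) (use assms in simp)
    then have "s * (g * c2) \<le> s * (g * c1)" using g assms by (intro mult_left_mono) simp_all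
    moreover have "n * (g * c1) \<le> 2 * s * (g * c1)" using g n assms by (intro mult_right_mono) simp_all
    moreover have "s * (3 * g * c1) \<le> s * h"
    proof (rule mult_left_mono)
      have "3 * g * c1 \<le> b * c1" using g assms by (intro mult_right_mono) simp_all
      then show "3 * g * c1 \<le> h" using h(1) by simp
    qed (use assms in simp)
    ultimately show ?thesis by (simp add: algebra_simps)
  qed
  then show ?thesis using assms by (simp add: g_def field_simps)
qed

text \<open>With \<open>g = b^2 / 8\<close>, a miss falls short of the target by \<open>g\<close>,
  while a hit exceeds it by at least \<open>g * n\<close>; so a single hit covers all
  misses.\<close>

lemma support_arith:
  fixes b n s :: real
  assumes "0 \<le> b" "b \<le> 1" "1 \<le> s" "s \<le> n"
  shows "b^2 / 8 * n \<le> (s * (b * n) + (n - s) * (b^2 / 8 * (n - 1))) / n"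
proof -
  define g where "g = b^2 / 8"
  have "b * b \<le> 1 * b" using assms by (intro mult_right_mono)
  then have g: "0 \<le> g" "8 * g \<le> b" by (simp_all add: g_def power2_eq_square)
  have "s * (2 * g * n) \<le> s * (b * n)" using g assms by (intro mult_left_mono mult_right_mono) simp_all
  moreover have "n * (g * n) \<le> s * (2 * g * n) + (n - s) * (g * (n - 1))"
  proof -
    have "g * n \<le> g * n * s" using g assms mult_left_mono[of 1 s "g * n"] by simp
    moreover have "0 \<le> g * s" using g assms by simp
    ultimately show ?thesis by (simp add: algebra_simps)
  qed
  ultimately have "n * (g * n) \<le> s * (b * n) + (n - s) * (g * (n - 1))" by linarith
  then show ?thesis using assms by (simp add: g_def field_simps)
qed

section \<open>Averaging over the eliminated vertex\<close>

context
  fixes V :: "nat set" and k :: nat and P Q :: "nat \<Rightarrow> nat set set pmf" and b :: real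
  assumes V: "finite V" "V \<noteq> {}" and b: "0 \<le> b" "b \<le> 1"
    and P: "\<And>v. v \<in> V \<Longrightarrow> spread k b (V - {v}) (P v)"
    and Q: "\<And>v. v \<in> V \<Longrightarrow> spread (Suc k) (b^2 / 8) (V - {v}) (Q v)"
    and Qs: "\<And>v. v \<in> V \<Longrightarrow> fills_support k b (V - {v}) (Q v)"
begin

lemma P_basis: "v \<in> V \<Longrightarrow> A \<in> set_pmf (P v) \<Longrightarrow> cycle_basis k (V - {v}) A"
  using P unfolding spread_def by blast

lemma Q_basis: "v \<in> V \<Longrightarrow> \<forall>B\<in>set_pmf (Q v). cycle_basis (Suc k) (V - {v}) B"
  using Q unfolding spread_def by blast

lemma finite_PQ: 
  assumes "v \<in> V"
  shows "finite (set_pmf (P v))" "finite (set_pmf (Q v))"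
  using finite_cycle_bases[of "V - {v}" "P v" k] finite_cycle_bases[of "V - {v}" "Q v" "Suc k"]
    assms P_basis Q_basis V by auto

lemma expect_cone:
  "expect (cone_pmf V P Q) h =
    (\<Sum>v\<in>V. expect (P v) (\<lambda>A. expect (Q v) (\<lambda>B. h (insert v ` A \<union> B)))) / real (card V)"
  using V finite_PQ by (intro expect_cone_pmf) auto

lemma expect_cone_lower:
  assumes "S \<subseteq> V"
    and "\<And>v. v \<in> S \<Longrightarrow> x \<le> expect (P v) (\<lambda>A. expect (Q v) (\<lambda>B. h (insert v ` A \<union> B)))"
    and "\<And>v. v \<in> V - S \<Longrightarrow> y \<le> expect (P v) (\<lambda>A. expect (Q v) (\<lambda>B. h (insert v ` A \<union> B)))"
  shows "(real (card S) * x + (real (card V) - real (card S)) * y) / real (card V) \<le> expect (cone_pmf V P Q) h"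
  unfolding expect_cone using assms V by (intro divide_right_mono sum_subset_lower_bound) auto

lemma card_cycle_bounds:
  assumes "is_cycle (Suc k) V Z" "Z \<noteq> {}"
  shows "k + 3 \<le> card (\<Union>Z)" "card (\<Union>Z) \<le> card V" "\<Union>Z \<subseteq> V"
proof -
  show *: "\<Union>Z \<subseteq> V" using is_cycle_support[OF assms(1)] .
  show "card (\<Union>Z) \<le> card V" using * V(1) by (rule card_mono[rotated])
  show "k + 3 \<le> card (\<Union>Z)" using card_support_cycle[OF V(1) assms] .
qed

lemma is_cycle_miss:
  assumes "is_cycle (Suc k) V Z" "v \<notin> \<Union>Z"
  shows "is_cycle (Suc k) (V - {v}) Z"
  using assms unfolding is_cycle_def by (intro conjI) auto

lemma expect_miss:
  assumes Z: "is_cycle (Suc k) V Z" and v: "v \<in> V - \<Union>Z"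
  shows "expect (P v) (\<lambda>A. expect (Q v) (\<lambda>B. h (filling (Suc k) Z (insert v ` A \<union> B))))
    = expect (Q v) (\<lambda>B. h (filling (Suc k) Z B))"
proof -
  have "expect (P v) (\<lambda>A. expect (Q v) (\<lambda>B. h (filling (Suc k) Z (insert v ` A \<union> B))))
    = expect (P v) (\<lambda>A. expect (Q v) (\<lambda>B. h (filling (Suc k) Z B)))"
    using filling_cone_miss[OF V(1) _ b(1) P Q_basis Z] v by (intro expect_cong) auto
  then show ?thesis by simp
qed

lemma binomial_split:
  assumes "k + 3 \<le> card V"
  shows "real ((card V - 1) choose (k + 2)) = real ((card V - 2) choose (k + 1)) + real ((card V - 2) choose (k + 2))"
    and "(real k + 2) * real ((card V - 2) choose (k + 2)) = (real (card V) - real k - 3) * real ((card V - 2) choose (k + 1))"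
proof -
  have "card V - 1 = Suc (card V - 2)" using assms by simp
  then show "real ((card V - 1) choose (k + 2)) = real ((card V - 2) choose (k + 1)) + real ((card V - 2) choose (k + 2))"
    by simp
  have "real ((k + 2) * ((card V - 2) choose (k + 2))) = real ((card V - k - 3) * ((card V - 2) choose (k + 1)))"
    using times_binomial_Suc[of "k + 1" "card V - 2"]
    by (intro arg_cong[where f = real]) (simp add: numeral_3_eq_3)
  then show "(real k + 2) * real ((card V - 2) choose (k + 2)) = (real (card V) - real k - 3) * real ((card V - 2) choose (k + 1))"
    using assms unfolding of_nat_mult by (simp add: of_nat_diff algebra_simps)
qed

lemma expect_hit:
  assumes Z: "is_cycle (Suc k) V Z" and v: "v \<in> \<Union>Z"
  defines "e \<equiv> expect (P v) (\<lambda>A. real (card (\<Union>(sym_diff (deletion v Z) (filling k (link v Z) A)))))"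
  shows "b * real ((card V - 2) choose (k + 1)) + b / 2 / (real (card V) - 1) * real ((card V - 2) choose (k + 2)) * e
    \<le> expect (P v) (\<lambda>A. expect (Q v) (\<lambda>B. real (card (filling (Suc k) Z (insert v ` A \<union> B)))))"
proof -
  have vV: "v \<in> V" using v is_cycle_support[OF Z] by auto
  have "k + 3 \<le> card V" using card_cycle_bounds[OF Z] v by fastforce
  then have card_minus: "card (V - {v}) = card V - 1" "real (card V - 1) = real (card V) - 1" "card V - 1 - 1 = card V - 2"
    using vV V by (simp_all add: of_nat_diff)
  show ?thesis
    unfolding e_def
  proof (rule expect_filling_hit[OF V(1) vV b(1) P[OF vV] Q_basis[OF vV] Z v])
    fix Y assume "is_cycle (Suc k) (V - {v}) Y"
    then show "b / 2 / (real (card V) - 1) * real ((card V - 2) choose (k + 2)) * real (card (\<Union>Y))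
      \<le> expect (Q v) (\<lambda>B. real (card (filling (Suc k) Y B)))"
      using Qs[OF vV, unfolded fills_support_def card_minus, rule_format, of Y] by (simp add: ac_simps)
  qed
qed

text \<open>A hit uses the first estimate of \<open>expect_support_residual\<close>, which relates
  the residual support to that of \<open>Z\<close>. A miss leaves \<open>Z\<close> as it is on one
  vertex fewer, where the bound is assumed.\<close>

lemma fills_support_cone: "fills_support k b V (cone_pmf V P Q)"
  unfolding fills_support_def
proof (intro allI impI)
  fix Z assume Z: "is_cycle (Suc k) V Z"
  show "b / 2 * (real (card (\<Union>Z)) / real (card V)) * real ((card V - 1) choose (k + 2))
       \<le> expect (cone_pmf V P Q) (\<lambda>T. real (card (filling (Suc k) Z T)))"
  proof (cases "Z = {}")
    case False
    note bounds = card_cycle_bounds[OF Z False]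
    have kn: "k + 3 \<le> card V" using bounds by simp
    define s where "s = real (card (\<Union>Z))"
    define c1 where "c1 = real ((card V - 2) choose (k + 1))"
    define c2 where "c2 = real ((card V - 2) choose (k + 2))"
    define e where "e = (s - 1) * (1 - (real k + 2) / (real (card V) - 1))"
    have n1: "real (card V - 1) = real (card V) - 1" using kn by (simp add: of_nat_diff)
    have s: "real k + 3 \<le> s" "s \<le> real (card V)" using bounds unfolding s_def by linarith+
    have "b / 2 * (s / real (card V)) * (c1 + c2) \<le>
      (s * (b * c1 + b / 2 / (real (card V) - 1) * c2 * e) + (real (card V) - s) * (b / 2 * (s / (real (card V) - 1)) * c2)) / real (card V)"
      using b s binomial_split(2)[OF kn] kn
      by (intro residual_arith[where k = "real k"]) (auto simp: c1_def c2_def e_def)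
    also have "\<dots> \<le> expect (cone_pmf V P Q) (\<lambda>T. real (card (filling (Suc k) Z T)))"
      unfolding s_def
    proof (rule expect_cone_lower[OF bounds(3)])
      fix v assume v: "v \<in> \<Union>Z"
      then have vV: "v \<in> V" using bounds by auto
      define e' where "e' = expect (P v) (\<lambda>A. real (card (\<Union>(sym_diff (deletion v Z) (filling k (link v Z) A)))))"
      have "e \<le> e'"
        using expect_support_residual(1)[OF V(1) vV b(1) P[OF vV] Q_basis[OF vV] Z v] n1
        unfolding e_def e'_def s_def by (simp add: add.commute)
      then have "b / 2 / (real (card V) - 1) * c2 * e \<le> b / 2 / (real (card V) - 1) * c2 * e'"
        using b kn by (intro mult_left_mono) (auto simp: c2_def)
      then show "b * c1 + b / 2 / (real (card V) - 1) * c2 * e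
        \<le> expect (P v) (\<lambda>A. expect (Q v) (\<lambda>B. real (card (filling (Suc k) Z (insert v ` A \<union> B)))))"
        using expect_hit[OF Z v] unfolding e'_def c1_def c2_def by linarith
    next
      fix v assume v: "v \<in> V - \<Union>Z"
      have "card V - 1 - 1 = card V - 2" by simp
      then show "b / 2 * (real (card (\<Union>Z)) / (real (card V) - 1)) * c2
        \<le> expect (P v) (\<lambda>A. expect (Q v) (\<lambda>B. real (card (filling (Suc k) Z (insert v ` A \<union> B)))))"
        using Qs[of v] is_cycle_miss[OF Z, of v] v V n1
        unfolding expect_miss[OF Z v, of "\<lambda>X. real (card X)"] fills_support_def c2_def by auto
    qed
    finally show ?thesis using binomial_split(1)[OF kn] unfolding s_def c1_def c2_def by simp
  qed (use b in simp)
qed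

text \<open>In contrast to \<open>fills_support_cone\<close>, a hit uses the second estimate of
  \<open>expect_support_residual\<close>, which is independent of the support of \<open>Z\<close>.
  Thus \<open>fills_support\<close> is applied to a residual cycle whose expected support is linear
  in the number of vertices.\<close>

lemma expect_filling_cone:
  assumes Z: "is_cycle (Suc k) V Z" "Z \<noteq> {}"
  shows "b^2 / 8 * real ((card V - 1) choose (k + 2)) \<le> expect (cone_pmf V P Q) (\<lambda>T. real (card (filling (Suc k) Z T)))"
proof -
  note bounds = card_cycle_bounds[OF Z]
  have kn: "k + 3 \<le> card V" using bounds by simp
  define s where "s = real (card (\<Union>Z))"
  define c1 where "c1 = real ((card V - 2) choose (k + 1))"
  define c2 where "c2 = real ((card V - 2) choose (k + 2))"
  \<comment> \<open>The second term presupposes that half of the old support survives; with fewer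
    vertices the cone has to suffice.\<close>
  define h where "h = (if 2 * (k + 2) \<le> card V - 1 then b * c1 + b^2 / 4 * c2 else b * c1)"
  have n1: "real (card V - 1) = real (card V) - 1" using kn by (simp add: of_nat_diff)
  have s: "real k + 3 \<le> s" "s \<le> real (card V)" using bounds unfolding s_def by linarith+
  have "b^2 / 8 * (c1 + c2) \<le> (s * h + (real (card V) - s) * (b^2 / 8 * c2)) / real (card V)"
  proof (rule filling_arith[where k = "real k"])
    show "b * c1 + b^2 / 4 * c2 \<le> h" if "2 * (real k + 2) \<le> real (card V) - 1"
    proof -
      have "real (2 * (k + 2)) \<le> real (card V - 1)" using that n1 by simp
      then have "2 * (k + 2) \<le> card V - 1" by (simp only: of_nat_le_iff)
      then show ?thesis by (simp add: h_def)
    qed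
    show "2 * (real k + 2) \<le> real (card V) - 1 \<or> real (card V) \<le> 2 * (real k + 2)"
    proof -
      have "2 * (k + 2) + 1 \<le> card V \<or> card V \<le> 2 * (k + 2)" by arith
      then have "real (2 * (k + 2) + 1) \<le> real (card V) \<or> real (card V) \<le> real (2 * (k + 2))"
        by (simp only: of_nat_le_iff)
      then show ?thesis by auto
    qed
  qed (use b s binomial_split(2)[OF kn] kn in \<open>auto simp: c1_def c2_def h_def\<close>)
  also have "\<dots> \<le> expect (cone_pmf V P Q) (\<lambda>T. real (card (filling (Suc k) Z T)))"
    unfolding s_def
  proof (rule expect_cone_lower[OF bounds(3)])
    fix v assume v: "v \<in> \<Union>Z"
    then have vV: "v \<in> V" using bounds by auto
    define e where "e = expect (P v) (\<lambda>A. real (card (\<Union>(sym_diff (deletion v Z) (filling k (link v Z) A)))))"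
    have "0 \<le> e" unfolding e_def by simp
    then have e0: "0 \<le> b / 2 / (real (card V) - 1) * c2 * e"
      using b kn by (intro mult_nonneg_nonneg) (auto simp: c2_def)
    have "h \<le> b * c1 + b / 2 / (real (card V) - 1) * c2 * e"
    proof (cases "2 * (k + 2) \<le> card V - 1")
      case True
      have "b * real (card V - 1) / 2 \<le> e"
        using expect_support_residual(2)[OF V(1) vV b(1) P[OF vV] Q_basis[OF vV] Z(1) v True]
        unfolding e_def by simp
      then have "b / 2 / (real (card V) - 1) * c2 * (b * real (card V - 1) / 2) \<le> b / 2 / (real (card V) - 1) * c2 * e"
        using b kn by (intro mult_left_mono) (auto simp: c2_def)
      \<comment> \<open>One factor \<open>b / 2\<close> comes from \<open>fills_support\<close>, the
        other from the support of the residual cycle.\<close>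
      moreover have "b / 2 / (real (card V) - 1) * c2 * (b * real (card V - 1) / 2) = b^2 / 4 * c2"
        using kn n1 by (simp add: field_simps power2_eq_square)
      moreover have h: "h = b * c1 + b^2 / 4 * c2" using True by (simp add: h_def)
      ultimately show ?thesis unfolding h by linarith
    qed (use e0 in \<open>simp add: h_def\<close>)
    then show "h \<le> expect (P v) (\<lambda>A. expect (Q v) (\<lambda>B. real (card (filling (Suc k) Z (insert v ` A \<union> B)))))"
      using expect_hit[OF Z(1) v] unfolding e_def c1_def c2_def by linarith
  next
    fix v assume v: "v \<in> V - \<Union>Z"
    have "card V - 1 - 1 = card V - 2" by simp
    then show "b^2 / 8 * c2
      \<le> expect (P v) (\<lambda>A. expect (Q v) (\<lambda>B. real (card (filling (Suc k) Z (insert v ` A \<union> B)))))"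
      using Q[of v] is_cycle_miss[OF Z(1), of v] v V Z(2)
      unfolding expect_miss[OF Z(1) v, of "\<lambda>X. real (card X)"] spread_def c2_def by auto
  qed
  finally show ?thesis using binomial_split(1)[OF kn] unfolding c1_def c2_def by simp
qed

lemma expect_support_cone:
  assumes Z: "is_cycle (Suc k) V Z" "Z \<noteq> {}"
  shows "b^2 / 8 * real (card V) \<le> expect (cone_pmf V P Q) (\<lambda>T. real (card (\<Union>(filling (Suc k) Z T))))"
proof -
  note bounds = card_cycle_bounds[OF Z]
  define s where "s = real (card (\<Union>Z))"
  have n1: "real (card V - 1) = real (card V) - 1" using bounds by (simp add: of_nat_diff)
  have s: "1 \<le> s" "s \<le> real (card V)" using bounds unfolding s_def by linarith+
  have "b^2 / 8 * real (card V) \<le> (s * (b * real (card V)) + (real (card V) - s) * (b^2 / 8 * (real (card V) - 1))) / real (card V)"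
    using b s by (rule support_arith)
  also have "\<dots> \<le> expect (cone_pmf V P Q) (\<lambda>T. real (card (\<Union>(filling (Suc k) Z T))))"
    unfolding s_def
  proof (rule expect_cone_lower[OF bounds(3)])
    fix v assume v: "v \<in> \<Union>Z"
    then have vV: "v \<in> V" using bounds by auto
    show "b * real (card V) \<le> expect (P v) (\<lambda>A. expect (Q v)
        (\<lambda>B. real (card (\<Union>(filling (Suc k) Z (insert v ` A \<union> B))))))"
      using expect_support_hit[OF V(1) vV b(1) P[OF vV] Q_basis[OF vV] Z(1) v b(2)] .
  next
    fix v assume v: "v \<in> V - \<Union>Z"
    then show "b^2 / 8 * (real (card V) - 1) \<le> expect (P v) (\<lambda>A. expect (Q v)
        (\<lambda>B. real (card (\<Union>(filling (Suc k) Z (insert v ` A \<union> B))))))"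
      using Q[of v] is_cycle_miss[OF Z(1), of v] V Z(2) n1
      unfolding expect_miss[OF Z(1) v, of "\<lambda>X. real (card (\<Union>X))"] spread_def by auto
  qed
  finally show ?thesis .
qed

text \<open>The bound is the average density: with \<open>n = card V\<close>, a hypertree has
  \<open>(n - 1) choose (k + 2)\<close> of the \<open>n choose (k + 3)\<close> simplices, a fraction
  \<open>(k + 3) / n\<close>. Hence averaging over \<open>v\<close> reproduces it without loss:
  \<tau> comes from \<open>A\<close> if it contains \<open>v\<close>, and from \<open>B\<close>
  otherwise.\<close>

lemma expect_member_cone:
  assumes "\<tau> \<subseteq> V" "card \<tau> = k + 3"
  shows "real (card V) * expect (cone_pmf V P Q) (\<lambda>T. of_bool (\<tau> \<in> T)) \<le> real k + 3"
proof -
  have kn: "k + 3 \<le> card V" using assms V card_mono by metis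
  have n1: "real (card V - 1) = real (card V) - 1" "0 < real (card V) - 1" using kn by (simp_all add: of_nat_diff)
  have cardW: "card (V - {v}) = card V - 1" if "v \<in> V" for v using that V by simp
  define X where "X = (\<lambda>v. expect (P v) (\<lambda>A. expect (Q v) (\<lambda>B. of_bool (\<tau> \<in> insert v ` A \<union> B))))"
  have free: "v \<notin> \<sigma>" if "v \<in> V" "A \<in> set_pmf (P v)" "\<sigma> \<in> A" for v A \<sigma>
    using cycle_basis_simplex(1)[OF P_basis[OF that(1,2)] that(3)] by auto
  have free': "v \<notin> \<sigma>" if "v \<in> V" "B \<in> set_pmf (Q v)" "\<sigma> \<in> B" for v B \<sigma>
    using cycle_basis_simplex(1)[OF Q_basis[OF that(1), rule_format, OF that(2)] that(3)] by auto
  \<comment> \<open>An upper bound for the sum of \<open>X\<close>, obtained as a lower bound for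
    the sum of its negative.\<close>
  have "real (card \<tau>) * (- ((real k + 2) / (real (card V) - 1))) +
      (real (card V) - real (card \<tau>)) * (- ((real k + 3) / (real (card V) - 1))) \<le> (\<Sum>v\<in>V. - X v)"
  proof (rule sum_subset_lower_bound[OF V(1) assms(1)])
    fix v assume v: "v \<in> \<tau>"
    then have vV: "v \<in> V" using assms by auto
    have "X v = expect (P v) (\<lambda>A. expect (Q v) (\<lambda>B. of_bool (\<tau> - {v} \<in> A)))"
      unfolding X_def
    proof (intro expect_cong arg_cong[where f = of_bool])
      fix A B assume A: "A \<in> set_pmf (P v)" and B: "B \<in> set_pmf (Q v)"
      have "\<tau> \<notin> B" using free'[OF vV B] v by auto
      moreover have "\<tau> \<in> insert v ` A \<longleftrightarrow> \<tau> - {v} \<in> A"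
      proof
        assume "\<tau> \<in> insert v ` A"
        then obtain \<sigma> where "\<sigma> \<in> A" "\<tau> = insert v \<sigma>" by blast
        then show "\<tau> - {v} \<in> A" using free[OF vV A] by simp
      next
        assume "\<tau> - {v} \<in> A"
        then have "insert v (\<tau> - {v}) \<in> insert v ` A" by blast
        then show "\<tau> \<in> insert v ` A" using v by (simp add: insert_absorb)
      qed
      ultimately show "(\<tau> \<in> insert v ` A \<union> B) = (\<tau> - {v} \<in> A)" by (simp only: Un_iff simp_thms)
    qed
    then have "X v = expect (P v) (\<lambda>A. of_bool (\<tau> - {v} \<in> A))" by simp
    moreover from assms v have "\<tau> - {v} \<subseteq> V - {v}" "card (\<tau> - {v}) = k + 2" by auto
    then have "(real (card V) - 1) * expect (P v) (\<lambda>A. of_bool (\<tau> - {v} \<in> A)) \<le> real k + 2"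
      using spread_member[OF P[OF vV]] cardW[OF vV] n1 by (simp add: add.commute)
    ultimately show "- ((real k + 2) / (real (card V) - 1)) \<le> - X v"
      using n1 by (simp add: field_simps)
  next
    fix v assume v: "v \<in> V - \<tau>"
    then have vV: "v \<in> V" by auto
    have "X v = expect (P v) (\<lambda>A. expect (Q v) (\<lambda>B. of_bool (\<tau> \<in> B)))"
      unfolding X_def using v by (intro expect_cong arg_cong[where f = of_bool]) auto
    then have "X v = expect (Q v) (\<lambda>B. of_bool (\<tau> \<in> B))" by simp
    moreover have "\<tau> \<subseteq> V - {v}" "card \<tau> = Suc k + 2" using assms v by auto
    then have "(real (card V) - 1) * expect (Q v) (\<lambda>A. of_bool (\<tau> \<in> A)) \<le> real k + 3"
      using spread_member[OF Q[OF vV]] cardW[OF vV] n1 by (simp add: add.commute)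
    ultimately show "- ((real k + 3) / (real (card V) - 1)) \<le> - X v"
      using n1 by (simp add: field_simps)
  qed
  then have "sum X V \<le> real (card \<tau>) * ((real k + 2) / (real (card V) - 1)) +
      (real (card V) - real (card \<tau>)) * ((real k + 3) / (real (card V) - 1))"
    by (simp add: sum_negf)
  also have "\<dots> = real k + 3" using n1 assms by (simp add: divide_simps) (simp add: algebra_simps)
  finally show ?thesis using expect_cone[of "\<lambda>T. of_bool (\<tau> \<in> T)"] kn unfolding X_def by simp
qed

lemma spread_cone: "spread (Suc k) (b^2 / 8) V (cone_pmf V P Q)"
  unfolding spread_def
proof (intro conjI ballI allI impI; (elim conjE)?)
  fix T assume "T \<in> set_pmf (cone_pmf V P Q)"
  then show "cycle_basis (Suc k) V T"
    using set_cone_pmf[OF V] cycle_basis_cone[OF V(1) _ P_basis] Q_basis by auto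
next
  fix \<tau> assume "\<tau> \<subseteq> V" "card \<tau> = Suc k + 2"
  then show "real (card V) * expect (cone_pmf V P Q) (\<lambda>T. of_bool (\<tau> \<in> T)) \<le> real (Suc k + 2)"
    using expect_member_cone[of \<tau>] by simp
next
  fix L assume "is_cycle (Suc k) V L" "L \<noteq> {}"
  then show "b^2 / 8 * real ((card V - 1) choose (Suc k + 1)) \<le> expect (cone_pmf V P Q) (\<lambda>T. real (card (filling (Suc k) L T)))"
    "b^2 / 8 * real (card V) \<le> expect (cone_pmf V P Q) (\<lambda>T. real (card (\<Union>(filling (Suc k) L T))))"
    using expect_filling_cone expect_support_cone by simp_all
qed

end

text \<open>Both properties go through the induction on the number of vertices together, because the
  cone step for \<open>spread\<close> uses \<open>fills_support\<close> on the smaller vertex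
  sets.\<close>

lemma spread_step:
  assumes "0 \<le> b" "b \<le> 1" and P: "\<And>V. finite V \<Longrightarrow> \<exists>p. spread k b V p"
  shows "finite V \<Longrightarrow> \<exists>q. spread (Suc k) (b^2 / 8) V q \<and> fills_support k b V q"
proof (induction "card V" arbitrary: V rule: less_induct)
  case less
  show ?case
  proof (cases "V = {}")
    \<comment> \<open>The only base is the empty family on no vertices: there is no nonzero cycle,
      and the fraction \<open>0 / 0\<close> in \<open>fills_support\<close> is 0.\<close>
    case True
    have "L = {}" if "is_cycle j {} L" for j L using that unfolding is_cycle_def by auto
    then have "cycle_basis (Suc k) {} {}" unfolding cycle_basis_def by fastforce
    moreover have "\<And>L. is_cycle (Suc k) {} L \<Longrightarrow> L = {}" by fact
    ultimately have "spread (Suc k) (b^2 / 8) V (return_pmf {}) \<and> fills_support k b V (return_pmf {})"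
      using True unfolding spread_def fills_support_def by auto
    then show ?thesis by blast
  next
    case False
    obtain P where P: "\<And>W. finite W \<Longrightarrow> spread k b W (P W)" using P by metis
    have "\<forall>v\<in>V. \<exists>q. spread (Suc k) (b^2 / 8) (V - {v}) q \<and> fills_support k b (V - {v}) q"
      using less by (blast intro: less.hyps card_Diff1_less)
    then obtain q where q: "\<And>v. v \<in> V \<Longrightarrow>
        spread (Suc k) (b^2 / 8) (V - {v}) (q v) \<and> fills_support k b (V - {v}) (q v)" by metis
    then show ?thesis
      using spread_cone[OF less.prems False assms(1,2), of k "\<lambda>v. P (V - {v})" q]
        fills_support_cone[OF less.prems False assms(1,2), of k "\<lambda>v. P (V - {v})" q] P less.prems by auto
  qed
qed

subsection \<open>Random Hamiltonian paths\<close>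

fun path_edges :: "nat list \<Rightarrow> nat set set" where
  "path_edges (v # w # xs) = insert {v, w} (path_edges (w # xs))"
| "path_edges _ = {}"

lemma path_edge_subset: "e \<in> path_edges xs \<Longrightarrow> e \<subseteq> set xs"
  by (induction xs rule: path_edges.induct) auto

lemma card_path_edge: "distinct xs \<Longrightarrow> e \<in> path_edges xs \<Longrightarrow> card e = 2"
  by (induction xs rule: path_edges.induct) auto

lemma finite_path_edges [simp]: "finite (path_edges xs)"
  by (induction xs rule: path_edges.induct) auto

lemma boundary_edge:
  assumes "v \<noteq> w"
  shows "boundary (Suc 0) {{v, w}} = {{v}, {w}}"
proof -
  have "odd (card {\<sigma> \<in> {{v, w}}. {x} \<subseteq> \<sigma>}) \<longleftrightarrow> x = v \<or> x = w" for x
  proof -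
    have "{\<sigma> \<in> {{v, w}}. {x} \<subseteq> \<sigma>} = (if x = v \<or> x = w then {{v, w}} else {})" by auto
    then show ?thesis by simp
  qed
  then show ?thesis unfolding boundary_def by (auto simp: card_1_singleton_iff simp del: insert_subset)
qed

lemma boundary_insert_edge:
  assumes "distinct (v # w # xs)" "F \<subseteq> path_edges (w # xs)"
  shows "boundary (Suc 0) (insert {v, w} F) = sym_diff {{v}, {w}} (boundary (Suc 0) F)"
proof -
  have "{v, w} \<notin> F" using assms path_edge_subset[of "{v, w}" "w # xs"] by auto
  then have "insert {v, w} F = sym_diff {{v, w}} F" by auto
  then have "boundary (Suc 0) (insert {v, w} F) = boundary (Suc 0) (sym_diff {{v, w}} F)" by (rule arg_cong)
  also have "\<dots> = sym_diff (boundary (Suc 0) {{v, w}}) (boundary (Suc 0) F)"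
    using finite_subset[OF assms(2)] by (intro boundary_sym_diff) auto
  finally show ?thesis using assms(1) by (simp add: boundary_edge)
qed

lemma is_cycle_0_iff:
  assumes "finite V"
  shows "is_cycle 0 V L \<longleftrightarrow> L \<subseteq> (\<lambda>x. {x}) ` V \<and> even (card L)"
proof -
  have "{\<sigma>. \<sigma> \<subseteq> V \<and> card \<sigma> = Suc 0} = (\<lambda>x. {x}) ` V" by (auto simp: card_1_singleton_iff)
  moreover have "boundary 0 L = {} \<longleftrightarrow> even (card L)" if L: "L \<subseteq> (\<lambda>x. {x}) ` V"
  proof -
    have "odd (card {\<sigma> \<in> L. \<tau> \<subseteq> \<sigma>}) \<longleftrightarrow> \<tau> = {} \<and> odd (card L)" if "card \<tau> = 0" for \<tau>
    proof (cases "\<tau> = {}")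
      case False
      \<comment> \<open>Infinite sets have \<open>card\<close> 0 and so pass the size condition of
        \<open>boundary 0\<close>, but no singleton contains one.\<close>
      then have "infinite \<tau>" using that by (simp add: card_eq_0_iff)
      then have "{\<sigma> \<in> L. \<tau> \<subseteq> \<sigma>} = {}" using L infinite_super by fastforce
      then show ?thesis using False by (simp del: Collect_empty_eq)
    qed simp
    then have "boundary 0 L = {\<tau>. \<tau> = {} \<and> odd (card L)}"
      unfolding boundary_def by (intro Collect_cong) auto
    then show ?thesis by auto
  qed
  ultimately show ?thesis unfolding is_cycle_def by auto
qed

lemma boundary_vertex:
  assumes "distinct (v # w # xs)" "F \<subseteq> path_edges (w # xs)"
  shows "{v} \<notin> boundary (Suc 0) F"
proof (rule ccontr)
  assume "\<not> ?thesis"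
  then have b: "{v} \<in> boundary (Suc 0) F" by simp
  have "v \<notin> \<sigma>" if "\<sigma> \<in> F" for \<sigma>
    using path_edge_subset[of \<sigma> "w # xs"] assms that by auto
  from boundary_vertex_free[OF this b] show False by simp
qed

text \<open>If \<open>{v}\<close> is in \<open>L\<close>, the only edge at the end vertex
  \<open>v\<close> must be used; it moves the point from \<open>v\<close> to \<open>w\<close>, where
  it may cancel.\<close>

lemma is_cycle_path_step:
  assumes "distinct (v # w # xs)" "is_cycle 0 (set (v # w # xs)) L"
  shows "is_cycle 0 (set (w # xs)) (if {v} \<in> L then sym_diff L {{v}, {w}} else L)"
proof -
  have L: "L \<subseteq> (\<lambda>x. {x}) ` set (v # w # xs)" "even (card L)"
    using assms(2) is_cycle_0_iff[of "set (v # w # xs)" L] by auto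
  have "finite L" using L(1) finite_subset by blast
  then have "odd (card (sym_diff L {{v}, {w}})) \<longleftrightarrow> odd (card L) \<noteq> odd (card {{v}, {w}})"
    by (intro odd_card_sym_diff) auto
  then have "even (card (sym_diff L {{v}, {w}}))" using L(2) assms(1) by simp
  then show ?thesis
    using L by (subst is_cycle_0_iff) auto
qed

lemma cycle_basis_path: "distinct xs \<Longrightarrow> cycle_basis 0 (set xs) (path_edges xs)"
proof (induction xs rule: path_edges.induct)
  case (1 v w xs)
  then have IH: "cycle_basis 0 (set (w # xs)) (path_edges (w # xs))" by simp
  show ?case
    unfolding cycle_basis_def
  proof (intro conjI allI impI)
    show "path_edges (v # w # xs) \<subseteq> {\<sigma>. \<sigma> \<subseteq> set (v # w # xs) \<and> card \<sigma> = Suc (Suc 0)}"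
      using path_edge_subset[of _ "v # w # xs"] card_path_edge[OF 1(2)] by (auto simp del: path_edges.simps)
  next
    fix Z assume Z: "Z \<subseteq> path_edges (v # w # xs)" "boundary (Suc 0) Z = {}"
    define F where "F = Z - {{v, w}}"
    have F: "F \<subseteq> path_edges (w # xs)" using Z F_def by auto
    have "{v, w} \<notin> Z"
    proof
      assume "{v, w} \<in> Z"
      then have "Z = insert {v, w} F" unfolding F_def by auto
      then have "{v} \<in> boundary (Suc 0) Z"
        using boundary_insert_edge[OF 1(2) F] boundary_vertex[OF 1(2) F] by simp
      then show False using Z by simp
    qed
    then have "Z \<subseteq> path_edges (w # xs)" using Z by auto
    then show "Z = {}" using IH Z(2) unfolding cycle_basis_def by blast
  next
    fix L assume L: "is_cycle 0 (set (v # w # xs)) L"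
    obtain F where F: "F \<subseteq> path_edges (w # xs)"
      "boundary (Suc 0) F = (if {v} \<in> L then sym_diff L {{v}, {w}} else L)"
      using filling_works[OF IH _ is_cycle_path_step[OF 1(2) L]] by blast
    show "\<exists>F\<subseteq>path_edges (v # w # xs). boundary (Suc 0) F = L"
    proof (cases "{v} \<in> L")
      case True
      have "boundary (Suc 0) (insert {v, w} F) = L"
        using boundary_insert_edge[OF 1(2) F(1)] F(2) True by auto
      then show ?thesis using F(1) by (intro exI[of _ "insert {v, w} F"]) auto
    qed (use F in auto)
  qed
next
  case "2_1"
  have "L = {}" if "is_cycle 0 {} L" for L using that is_cycle_0_iff[of "{}" L] by auto
  then show ?case unfolding cycle_basis_def by auto
next
  case ("2_2" v)
  have "L = {}" if "is_cycle 0 {v} L" for L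
    using that is_cycle_0_iff[of "{v}" L] by (auto simp: subset_singleton_iff)
  then show ?case unfolding cycle_basis_def by auto
qed

lemma filling_path:
  assumes "distinct (v # w # xs)" "is_cycle 0 (set (v # w # xs)) L"
  shows "filling 0 L (path_edges (v # w # xs)) =
    (if {v} \<in> L then insert {v, w} (filling 0 (sym_diff L {{v}, {w}}) (path_edges (w # xs)))
     else filling 0 L (path_edges (w # xs)))"
proof (rule filling_eqI[OF cycle_basis_path[OF assms(1)]])
  let ?L = "if {v} \<in> L then sym_diff L {{v}, {w}} else L"
  have "cycle_basis 0 (set (w # xs)) (path_edges (w # xs))"
    using assms(1) by (intro cycle_basis_path) simp
  note F = filling_works[OF this _ is_cycle_path_step[OF assms]]
  show "(if {v} \<in> L then insert {v, w} (filling 0 (sym_diff L {{v}, {w}}) (path_edges (w # xs)))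
     else filling 0 L (path_edges (w # xs))) \<subseteq> path_edges (v # w # xs)"
    using F(1) by (auto split: if_splits)
  show "boundary (Suc 0) (if {v} \<in> L then insert {v, w} (filling 0 (sym_diff L {{v}, {w}}) (path_edges (w # xs)))
     else filling 0 L (path_edges (w # xs))) = L"
    using F boundary_insert_edge[OF assms(1), of "filling 0 ?L (path_edges (w # xs))"]
    by (cases "{v} \<in> L") auto
qed simp

text \<open>
  For an even vertex set this is the size of its filling in the path; odd sets are included because
  the recursion over the first vertex passes through them.
\<close>

fun odd_suffixes :: "nat set set \<Rightarrow> nat list \<Rightarrow> nat" where
  "odd_suffixes L [] = 0"
| "odd_suffixes L (v # xs) = odd_suffixes L xs + of_bool (odd (card {x \<in> set (v # xs). {x} \<in> L}))"

lemma odd_suffixes_cong: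
  "(\<And>x. x \<in> set xs \<Longrightarrow> {x} \<in> L \<longleftrightarrow> {x} \<in> M) \<Longrightarrow> odd_suffixes L xs = odd_suffixes M xs"
proof (induction xs)
  case (Cons v xs)
  then have "{x \<in> set (v # xs). {x} \<in> L} = {x \<in> set (v # xs). {x} \<in> M}" by auto
  then show ?case using Cons by simp
qed simp

lemma card_singletons:
  assumes "finite V" "L \<subseteq> (\<lambda>x. {x}) ` V"
  shows "card L = card {x \<in> V. {x} \<in> L}"
proof -
  have "L = (\<lambda>x. {x}) ` {x \<in> V. {x} \<in> L}" using assms(2) by auto
  then have "card L = card ((\<lambda>x. {x}) ` {x \<in> V. {x} \<in> L})" by (rule arg_cong)
  then show ?thesis by (simp add: card_image)
qed

lemma even_card_cycle_0:
  assumes "finite V" "is_cycle 0 V L"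
  shows "even (card {x \<in> V. {x} \<in> L})"
  using assms is_cycle_0_iff[of V L] card_singletons[of V L] by simp

text \<open>Cutting the path at an edge leaves a suffix, and the edge lies in the filling iff this
  suffix has an odd number of points of \<open>L\<close>. The whole list is counted as a suffix too,
  but for a cycle its number is even.\<close>

lemma card_filling_path:
  "distinct xs \<Longrightarrow> is_cycle 0 (set xs) L \<Longrightarrow> card (filling 0 L (path_edges xs)) = odd_suffixes L xs"
proof (induction xs arbitrary: L rule: path_edges.induct)
  case (1 v w xs)
  let ?L = "if {v} \<in> L then sym_diff L {{v}, {w}} else L"
  note c = is_cycle_path_step[OF 1(2,3)]
  have d: "distinct (w # xs)" using 1(2) by simp
  have IH: "card (filling 0 ?L (path_edges (w # xs))) = odd_suffixes ?L (w # xs)"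
    using 1(1)[OF d c] .
  have ev: "even (card {x \<in> set (w # xs). {x} \<in> ?L})" "even (card {x \<in> set (v # w # xs). {x} \<in> L})"
    using even_card_cycle_0[OF _ c] even_card_cycle_0[OF _ 1(3)] by auto
  have sub: "filling 0 ?L (path_edges (w # xs)) \<subseteq> path_edges (w # xs)"
    using filling_works(1)[OF cycle_basis_path[OF d] _ c] by simp
  \<comment> \<open>Toggling \<open>v\<close> and \<open>w\<close> does not affect the suffixes of
    \<open>xs\<close>, and \<open>w # xs\<close> itself is even for \<open>?L\<close>, so it adds
    nothing.\<close>
  have "odd_suffixes ?L xs = odd_suffixes L xs"
    using 1(2) by (intro odd_suffixes_cong) auto
  then have IH': "card (filling 0 ?L (path_edges (w # xs))) = odd_suffixes L xs"
    using IH ev(1) by (simp del: Collect_empty_eq)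
  show ?case
  proof (cases "{v} \<in> L")
    case True
    have "{v, w} \<notin> path_edges (w # xs)"
      using 1(2) path_edge_subset[of "{v, w}" "w # xs"] by auto
    then have "{v, w} \<notin> filling 0 ?L (path_edges (w # xs))" using sub by blast
    then have "card (filling 0 L (path_edges (v # w # xs))) = Suc (odd_suffixes L xs)"
      using filling_path[OF 1(2,3)] True IH' finite_subset[OF sub] by simp
    moreover have "odd (card {x \<in> set (w # xs). {x} \<in> L})"
    proof -
      have "{x \<in> set (v # w # xs). {x} \<in> L} = insert v {x \<in> set (w # xs). {x} \<in> L}"
        using True by auto
      moreover have "v \<notin> {x \<in> set (w # xs). {x} \<in> L}" using 1(2) by auto
      ultimately show ?thesis using ev(2) by simp
    qed
    ultimately show ?thesis using ev(2) by simp
  next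
    case False
    then have "card (filling 0 L (path_edges (v # w # xs))) = odd_suffixes L (w # xs)"
      using filling_path[OF 1(2,3)] IH by simp
    then show ?thesis using ev(2) by simp
  qed
next
  case "2_1"
  then have "L = {}" using is_cycle_0_iff[of "{}" L] by auto
  then show ?case using filling_empty[OF cycle_basis_path[of "[]"]] by simp
next
  case ("2_2" v)
  then have "L = {}" using is_cycle_0_iff[of "{v}" L] by (auto simp: subset_singleton_iff)
  then show ?case using filling_empty[OF cycle_basis_path[of "[v]"]] by simp
qed

text \<open>Read from the front, each edge of \<open>F\<close> brings its first vertex, which no
  later edge contains. With this the size bound for fillings in a path also serves as the support
  bound.\<close>

lemma card_support_path:
  "distinct xs \<Longrightarrow> F \<subseteq> path_edges xs \<Longrightarrow> card F \<le> card (\<Union>F)"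
proof (induction xs arbitrary: F rule: path_edges.induct)
  case (1 v w xs)
  define G where "G = F - {{v, w}}"
  have G: "G \<subseteq> path_edges (w # xs)" using 1(3) unfolding G_def by auto
  then have IH: "card G \<le> card (\<Union>G)" using 1 by simp
  show ?case
  proof (cases "{v, w} \<in> F")
    case True
    have GV: "\<Union>G \<subseteq> set (w # xs)" using G path_edge_subset by blast
    have "card F = Suc (card G)"
      unfolding G_def using True finite_subset[OF 1(3)] by (intro card.remove) simp_all
    also have "\<dots> \<le> Suc (card (\<Union>G))" using IH by simp
    also have "\<dots> = card (insert v (\<Union>G))"
      using GV 1(2) finite_subset[OF GV] by (subst card_insert_disjoint) auto
    also have "\<dots> \<le> card (\<Union>F)"
    proof (rule card_mono)
      have "\<Union>F \<subseteq> set (v # w # xs)" using 1(3) path_edge_subset by blast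
      then show "finite (\<Union>F)" by (rule finite_subset) simp
      show "insert v (\<Union>G) \<subseteq> \<Union>F" using True unfolding G_def by auto
    qed
    finally show ?thesis .
  next
    case False
    then have "F = G" unfolding G_def by simp
    then show ?thesis using IH by simp
  qed
qed auto

section \<open>Random permutations\<close>

abbreviation random_perm :: "nat set \<Rightarrow> nat list pmf" where
  "random_perm V \<equiv> pmf_of_set (permutations_of_set V)"

lemma expect_random_perm:
  assumes "finite V" "V \<noteq> {}"
  shows "expect (random_perm V) h =
    (\<Sum>v\<in>V. expect (random_perm (V - {v})) (\<lambda>xs. h (v # xs))) / real (card V)"
proof -
  have e: "expect (random_perm W) g = sum g (permutations_of_set W) / fact (card W)" if "finite W" for W g
    using that by (subst integral_pmf_of_set) auto
  have "sum h (permutations_of_set V) =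
    (\<Sum>v\<in>V. sum h ((\<lambda>xs. v # xs) ` permutations_of_set (V - {v})))"
    unfolding permutations_of_set_nonempty[OF assms(2)]
    using assms(1) by (intro sum.UNION_disjoint) auto
  also have "\<dots> = (\<Sum>v\<in>V. \<Sum>xs\<in>permutations_of_set (V - {v}). h (v # xs))"
    by (rule sum.cong[OF refl]) (simp add: sum.reindex)
  also have "\<dots> = (\<Sum>v\<in>V. fact (card V - 1) * expect (random_perm (V - {v})) (\<lambda>xs. h (v # xs)))"
    using assms by (intro sum.cong refl) (simp add: e)
  finally have "sum h (permutations_of_set V) =
      fact (card V - 1) * (\<Sum>v\<in>V. expect (random_perm (V - {v})) (\<lambda>xs. h (v # xs)))"
    by (simp add: sum_distrib_left)
  moreover have "fact (card V) = real (card V) * fact (card V - 1)"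
    using assms by (intro fact_reduce) (simp add: card_gt_0_iff)
  ultimately show ?thesis using assms(1) by (simp add: e)
qed

lemma set_random_perm: "finite V \<Longrightarrow> set_pmf (random_perm V) = permutations_of_set V"
  by (rule set_pmf_of_set) auto

lemma random_permD: "finite V \<Longrightarrow> xs \<in> set_pmf (random_perm V) \<Longrightarrow> set xs = V \<and> distinct xs"
  using permutations_of_setD by (auto simp: set_random_perm)

lemma finite_random_perm: "finite V \<Longrightarrow> finite (set_pmf (random_perm V))"
  by (simp add: set_random_perm)

lemma sum_subset_const:
  assumes "finite V" "S \<subseteq> V" "\<And>v. v \<in> S \<Longrightarrow> X v = h" "\<And>v. v \<in> V - S \<Longrightarrow> X v = m"
  shows "sum X V = real (card S) * h + (real (card V) - real (card S)) * (m :: real)"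
  using sum_subset_lower_bound[of V S h X m] sum_subset_lower_bound[of V S "- h" "\<lambda>v. - X v" "- m"] assms
  by (simp add: sum_negf)

text \<open>Let \<open>n = card V\<close>. Sort the \<open>n + 1\<close> suffixes, the empty one
  included, by their number of marked points: by symmetry each of the values 0 to \<open>s\<close>
  has expected frequency \<open>(n + 1) / (s + 1)\<close>. Among them \<open>s / 2\<close> or
  \<open>(s + 1) / 2\<close> are odd, which explains the formula; the proof verifies it by recursion
  on the first entry.\<close>

lemma expect_odd_suffixes:
  assumes "finite V"
  shows "expect (random_perm V) (\<lambda>xs. real (odd_suffixes L xs)) =
    (let s = card {x \<in> V. {x} \<in> L} in
     if even s then real s * (real (card V) + 1) / (2 * (real s + 1)) else (real (card V) + 1) / 2)"
  using assms
proof (induction "card V" arbitrary: V rule: less_induct)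
  case less
  show ?case
  proof (cases "V = {}")
    case True
    then show ?thesis by (simp add: pmf_of_set_singleton)
  next
    case False
    define S where "S = {x \<in> V. {x} \<in> L}"
    define s where "s = card S"
    define n where "n = card V"
    have n0: "0 < n" using False less.prems by (simp add: n_def card_gt_0_iff)
    have S: "S \<subseteq> V" "finite S" using less.prems unfolding S_def by auto
    have sn: "s \<le> n" unfolding s_def n_def using S less.prems by (intro card_mono)
    define f where "f = (\<lambda>n s. if even s then real s * (real n + 1) / (2 * (real s + 1)) else (real n + 1) / 2)"
    have X: "expect (random_perm (V - {v})) (\<lambda>xs. real (odd_suffixes L (v # xs))) =
      f (n - 1) (card (S - {v})) + of_bool (odd s)" if v: "v \<in> V" for v
    proof -
      have "odd_suffixes L (v # xs) = odd_suffixes L xs + of_bool (odd s)"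
        if "xs \<in> set_pmf (random_perm (V - {v}))" for xs
      proof -
        have "set (v # xs) = V" using random_permD[OF _ that] less.prems v by auto
        then have "card {x \<in> set (v # xs). {x} \<in> L} = s" unfolding s_def S_def by simp
        then show ?thesis by (simp only: odd_suffixes.simps)
      qed
      then have "expect (random_perm (V - {v})) (\<lambda>xs. real (odd_suffixes L (v # xs))) =
        expect (random_perm (V - {v})) (\<lambda>xs. real (odd_suffixes L xs) + of_bool (odd s))"
        by (intro expect_cong) simp
      also have "\<dots> = expect (random_perm (V - {v})) (\<lambda>xs. real (odd_suffixes L xs)) + of_bool (odd s)"
        using less.prems by (simp add: expect_add finite_random_perm)
      also have "expect (random_perm (V - {v})) (\<lambda>xs. real (odd_suffixes L xs)) = f (n - 1) (card (S - {v}))"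
      proof -
        have "{x \<in> V - {v}. {x} \<in> L} = S - {v}" unfolding S_def by auto
        moreover have "card (V - {v}) < card V" using v less.prems by (rule card_Diff1_less[rotated])
        moreover have "card (V - {v}) = n - 1" using v less.prems by (simp add: n_def)
        ultimately show ?thesis
          using less.hyps[of "V - {v}"] less.prems by (simp add: f_def Let_def)
      qed
      finally show ?thesis .
    qed
    have "(\<Sum>v\<in>V. expect (random_perm (V - {v})) (\<lambda>xs. real (odd_suffixes L (v # xs)))) =
      real s * (f (n - 1) (s - 1) + of_bool (odd s)) + (real n - real s) * (f (n - 1) s + of_bool (odd s))"
      unfolding s_def n_def
      by (rule sum_subset_const) (use S X less.prems in \<open>auto simp: s_def n_def\<close>)
    also have "\<dots> = real n * f n s"
    proof (cases "s = 0")
      case False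
      have r: "real (n - Suc 0) = real n - 1" "real (s - Suc 0) = real s - 1"
        using n0 False by (simp_all add: of_nat_diff)
      show ?thesis
      proof (cases "even s")
        case True
        then have "odd (s - 1)" using False by simp
        then show ?thesis using True by (simp add: f_def r divide_simps) (simp add: algebra_simps)
      next
        case odd: False
        then have "even (s - 1)" by simp
        then show ?thesis using odd False by (simp add: f_def r divide_simps) (simp add: algebra_simps)
      qed
    qed (simp add: f_def)
    finally show ?thesis
      using expect_random_perm[OF less.prems False, of "\<lambda>xs. real (odd_suffixes L xs)"] n0
      unfolding f_def Let_def n_def[symmetric] s_def[symmetric] S_def[symmetric] by simp
  qed
qed

lemma expect_hd:
  assumes "finite V" "b \<in> V"
  shows "expect (random_perm V) (\<lambda>xs. of_bool (xs \<noteq> [] \<and> hd xs = b)) = 1 / real (card V)"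
proof -
  have "expect (random_perm V) (\<lambda>xs. of_bool (xs \<noteq> [] \<and> hd xs = b)) = (\<Sum>v\<in>V. of_bool (v = b)) / real (card V)"
    using assms by (subst expect_random_perm) auto
  also have "(\<Sum>v\<in>V. of_bool (v = b)) = (1 :: real)" using assms by (simp add: of_bool_def)
  finally show ?thesis .
qed

lemma path_edges_Cons:
  "path_edges (v # xs) = (if xs = [] then {} else insert {v, hd xs} (path_edges xs))"
  by (cases xs) auto

text \<open>A path on \<open>n\<close> vertices has \<open>n - 1\<close> of the
  \<open>n choose 2\<close> edges, a density of \<open>2 / n\<close>, and conditioning on the first
  vertex \<open>v\<close> preserves it: an edge at \<open>v\<close> occurs only if its other end
  comes next.\<close>

lemma expect_path_edge:
  assumes "finite V" "e \<subseteq> V" "card e = 2"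
  shows "real (card V) * expect (random_perm V) (\<lambda>xs. of_bool (e \<in> path_edges xs)) \<le> 2"
  using assms(1,2)
proof (induction "card V" arbitrary: V rule: less_induct)
  case less
  define n where "n = card V"
  have n2: "2 \<le> n" using card_mono[OF less.prems] assms(3) n_def by simp
  then have ne: "V \<noteq> {}" "real (n - 1) = real n - 1" "0 < real n - 1" by (auto simp: n_def of_nat_diff)
  have cardW: "card (V - {v}) = n - 1" if "v \<in> V" for v using that less.prems n_def by simp
  define X where "X = (\<lambda>v. expect (random_perm (V - {v})) (\<lambda>xs. of_bool (e \<in> path_edges (v # xs))))"
  have "real (card e) * - (1 / (real n - 1)) + (real (card V) - real (card e)) * - (2 / (real n - 1)) \<le> (\<Sum>v\<in>V. - X v)"
  proof (rule sum_subset_lower_bound[OF less.prems])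
    fix v assume v: "v \<in> e"
    then have vV: "v \<in> V" using less.prems by auto
    obtain b where b: "e = {v, b}" "b \<noteq> v" using v assms(3) by (auto simp: card_2_iff)
    have "X v \<le> expect (random_perm (V - {v})) (\<lambda>xs. of_bool (xs \<noteq> [] \<and> hd xs = b))"
      unfolding X_def
    proof (rule expect_mono)
      fix xs assume xs: "xs \<in> set_pmf (random_perm (V - {v}))"
      have "e \<notin> path_edges xs"
        using path_edge_subset[of e xs] random_permD[OF _ xs] less.prems v by auto
      then show "of_bool (e \<in> path_edges (v # xs)) \<le> (of_bool (xs \<noteq> [] \<and> hd xs = b) :: real)"
        using b by (auto simp: path_edges_Cons doubleton_eq_iff)
    qed (use less.prems finite_random_perm in auto)
    also have "\<dots> = 1 / real (card (V - {v}))" using less.prems b by (intro expect_hd) auto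
    finally show "- (1 / (real n - 1)) \<le> - X v" using cardW[OF vV] ne by simp
  next
    fix v assume v: "v \<in> V - e"
    then have vV: "v \<in> V" by auto
    have "X v \<le> expect (random_perm (V - {v})) (\<lambda>xs. of_bool (e \<in> path_edges xs))"
      unfolding X_def
      by (rule expect_mono) (use v less.prems finite_random_perm in \<open>auto simp: path_edges_Cons\<close>)
    moreover have "real (card (V - {v})) * expect (random_perm (V - {v})) (\<lambda>xs. of_bool (e \<in> path_edges xs)) \<le> 2"
      using v less.prems by (intro less.hyps card_Diff1_less) auto
    then have "expect (random_perm (V - {v})) (\<lambda>xs. of_bool (e \<in> path_edges xs)) \<le> 2 / (real n - 1)"
      using cardW[OF vV] ne by (simp add: field_simps)
    ultimately show "- (2 / (real n - 1)) \<le> - X v" by simp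
  qed
  then have "sum X V \<le> 2 * (1 / (real n - 1)) + (real n - 2) * (2 / (real n - 1))"
    using assms(3) by (simp add: sum_negf n_def)
  also have "\<dots> = 2" using ne(3) by (simp add: divide_simps) (simp add: algebra_simps)
  finally show ?case
    using expect_random_perm[OF less.prems(1) ne(1)] n2 unfolding X_def n_def by simp
qed

lemma spread_path:
  assumes "finite V"
  shows "spread 0 (1/3) V (map_pmf path_edges (random_perm V))"
  unfolding spread_def
proof (intro conjI ballI allI impI; (elim conjE)?)
  fix T assume "T \<in> set_pmf (map_pmf path_edges (random_perm V))"
  then obtain xs where "xs \<in> set_pmf (random_perm V)" "T = path_edges xs" by auto
  then show "cycle_basis 0 V T" using random_permD[OF assms] cycle_basis_path by auto
next
  fix \<tau> assume "\<tau> \<subseteq> V" "card \<tau> = 0 + 2"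
  then show "real (card V) * expect (map_pmf path_edges (random_perm V)) (\<lambda>T. of_bool (\<tau> \<in> T)) \<le> real (0 + 2)"
    using expect_path_edge[OF assms, of \<tau>] by simp
next
  fix L assume L: "is_cycle 0 V L" "L \<noteq> {}"
  define s where "s = card {x \<in> V. {x} \<in> L}"
  define e where "e = expect (random_perm V) (\<lambda>xs. real (odd_suffixes L xs))"
  have LV: "L \<subseteq> (\<lambda>x. {x}) ` V" "even (card L)" using L is_cycle_0_iff[OF assms] by auto
  then have s: "s = card L" "even s" "0 < s"
    using card_singletons[OF assms LV(1)] L(2) finite_subset[OF LV(1)] assms 
    by (auto simp: s_def card_gt_0_iff)
  then have s2: "2 \<le> real s" by (auto elim!: evenE)
  \<comment> \<open>The quotient \<open>s / (2 * (s + 1))\<close> increases with \<open>s\<close>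
    and equals 1/3 at \<open>s = 2\<close>, the least positive even size.\<close>
  have "(real (card V) + 1) / 3 \<le> real s * (real (card V) + 1) / (2 * (real s + 1))"
  proof -
    have "(real (card V) + 1) * (2 * (real s + 1)) \<le> (real (card V) + 1) * (3 * real s)"
      using s2 by (intro mult_left_mono) simp_all
    then show ?thesis by (simp add: field_simps)
  qed
  moreover have "e = real s * (real (card V) + 1) / (2 * (real s + 1))"
    using expect_odd_suffixes[OF assms, of L] s(2) unfolding s_def e_def by (simp add: Let_def)
  ultimately have e: "(real (card V) + 1) / 3 \<le> e" by simp
  have c: "card (filling 0 L (path_edges xs)) = odd_suffixes L xs"
      "odd_suffixes L xs \<le> card (\<Union>(filling 0 L (path_edges xs)))"
    if "xs \<in> set_pmf (random_perm V)" for xs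
  proof -
    have xs: "set xs = V" "distinct xs" using random_permD[OF assms that] by auto
    show *: "card (filling 0 L (path_edges xs)) = odd_suffixes L xs"
      using card_filling_path[OF xs(2)] L xs by simp
    have "filling 0 L (path_edges xs) \<subseteq> path_edges xs"
      using filling_works(1)[OF cycle_basis_path[OF xs(2)]] xs(1) L(1) assms by simp
    then show "odd_suffixes L xs \<le> card (\<Union>(filling 0 L (path_edges xs)))"
      using card_support_path[OF xs(2)] * by metis
  qed
  have "e = expect (random_perm V) (\<lambda>xs. real (card (filling 0 L (path_edges xs))))"
    unfolding e_def using c(1) by (intro expect_cong) simp
  then show "1/3 * real ((card V - 1) choose (0 + 1)) \<le> expect (map_pmf path_edges (random_perm V)) (\<lambda>T. real (card (filling 0 L T)))"
    using e by simp
  have "e \<le> expect (random_perm V) (\<lambda>xs. real (card (\<Union>(filling 0 L (path_edges xs)))))"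
    unfolding e_def using c(2) finite_random_perm[OF assms] by (intro expect_mono) simp_all
  then show "1/3 * real (card V) \<le> expect (map_pmf path_edges (random_perm V)) (\<lambda>T. real (card (\<Union>(filling 0 L T))))"
    using e by simp
qed

subsection \<open>Hypertrees with large fillings\<close>

text \<open>In terms of \<open>b / 8\<close>, the step from \<open>b\<close> to
  \<open>b^2 / 8\<close> is squaring, and it starts at \<open>1/24\<close>.\<close>

lemma spread_exists:
  assumes "finite V"
  shows "\<exists>p. spread k (8 * (1/24) ^ (2 ^ k)) V p"
  using assms
proof (induction k arbitrary: V)
  case 0
  then show ?case using spread_path by auto
next
  case (Suc k)
  define b :: real where "b = 8 * (1/24) ^ (2 ^ k)"
  have "(1/24 :: real) ^ (2 ^ k) \<le> (1/24) ^ 1" by (intro power_decreasing) auto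
  then have "0 \<le> b" "b \<le> 1" by (auto simp: b_def)
  then obtain q where "spread (Suc k) (b^2 / 8) V q"
    using spread_step[of b k V] Suc b_def by blast
  moreover have "b^2 / 8 = 8 * (1/24) ^ (2 ^ Suc k)"
    unfolding b_def power_Suc power_even_eq by (simp add: power_mult_distrib)
  ultimately show ?case by metis
qed

text \<open>Equality holds for \<open>k = 0\<close>. Afterwards the left side is cubed and the right
  side squared, up to constants, and \<open>y \<le> 1\<close> gives
  \<open>y^3 \<le> y^2\<close>.\<close>

lemma c_const_le: "c_const (Suc k) \<le> 8 * (1/24) ^ (2 ^ k)"
proof -
  have c: "c_const (Suc k) = 16 * (1/48) ^ (3 ^ k)" for k
  proof -
    have "(48 :: real) powi (- (3 ^ k)) = inverse (48 powi (int (3 ^ k)))" by (simp add: power_int_minus)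
    also have "\<dots> = (1/48) ^ (3 ^ k)" unfolding power_int_of_nat by (simp add: power_one_over inverse_eq_divide)
    finally show ?thesis by (simp add: c_const_def)
  qed
  show ?thesis
  proof (induction k)
    case 0
    then show ?case by (simp add: c)
  next
    case (Suc k)
    define x y :: real where "x = (1/48) ^ (3 ^ k)" and "y = (1/24) ^ (2 ^ k)"
    have "0 \<le> x" "0 \<le> y" "y \<le> 1" by (auto simp: x_def y_def intro: power_le_one)
    have "2 * x \<le> y" using Suc by (simp add: c x_def y_def)
    then have "(2 * x)^3 \<le> y^3" using \<open>0 \<le> x\<close> by (intro power_mono) simp_all
    also have "y^3 \<le> y^2" using \<open>0 \<le> y\<close> \<open>y \<le> 1\<close> by (intro power_decreasing) simp_all
    finally have "8 * x^3 \<le> y^2" by (simp add: power_mult_distrib)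
    then have "16 * x^3 \<le> 8 * y^2" using zero_le_power2[of y] by linarith
    moreover have "(1/48 :: real) ^ (3 ^ Suc k) = x^3" "(1/24 :: real) ^ (2 ^ Suc k) = y^2"
      by (simp_all add: x_def y_def power_mult[symmetric] mult.commute)
    ultimately show ?case by (simp add: c)
  qed
qed

text \<open>A subset \<rho> of \<sigma> with \<open>k\<close> elements lies in exactly two facets of
  \<sigma>, one for each element of \<open>\<sigma> - \<rho>\<close>.\<close>

lemma is_cycle_simplex_boundary:
  assumes "finite V" "\<sigma> \<subseteq> V" "card \<sigma> = Suc (Suc k)"
  shows "is_cycle k V (boundary (Suc k) {\<sigma>})" "boundary (Suc k) {\<sigma>} \<noteq> {}"
proof -
  have fin: "finite \<sigma>" using assms finite_subset by auto
  have eq: "boundary (Suc k) {\<sigma>} = {\<tau>. \<tau> \<subseteq> \<sigma> \<and> card \<tau> = Suc k}"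
  proof -
    have "{\<rho> \<in> {\<sigma>}. \<tau> \<subseteq> \<rho>} = (if \<tau> \<subseteq> \<sigma> then {\<sigma>} else {})" for \<tau> by auto
    then show ?thesis unfolding boundary_def by auto
  qed
  have "Suc k \<le> card \<sigma>" using assms(3) by simp
  then obtain \<tau> where "\<tau> \<subseteq> \<sigma>" "card \<tau> = Suc k"
    by (rule obtain_subset_with_card_n)
  then show "boundary (Suc k) {\<sigma>} \<noteq> {}" unfolding eq by blast
  have "even (card {\<tau> \<in> boundary (Suc k) {\<sigma>}. \<rho> \<subseteq> \<tau>})" if "card \<rho> = k" for \<rho>
  proof (cases "\<rho> \<subseteq> \<sigma>")
    case True
    then have fr: "finite \<rho>" using fin finite_subset by auto
    have "{\<tau> \<in> boundary (Suc k) {\<sigma>}. \<rho> \<subseteq> \<tau>} = (\<lambda>x. insert x \<rho>) ` (\<sigma> - \<rho>)"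
    proof (intro equalityI subsetI)
      fix \<tau> assume "\<tau> \<in> {\<tau> \<in> boundary (Suc k) {\<sigma>}. \<rho> \<subseteq> \<tau>}"
      then have \<tau>: "\<tau> \<subseteq> \<sigma>" "card \<tau> = Suc k" "\<rho> \<subseteq> \<tau>" unfolding eq by auto
      then have "card (\<tau> - \<rho>) = 1" using fr that by (simp add: card_Diff_subset)
      then obtain x where "\<tau> - \<rho> = {x}" by (rule card_1_singletonE)
      then show "\<tau> \<in> (\<lambda>x. insert x \<rho>) ` (\<sigma> - \<rho>)" using \<tau> by (intro image_eqI[of _ _ x]) auto
    next
      fix \<tau> assume "\<tau> \<in> (\<lambda>x. insert x \<rho>) ` (\<sigma> - \<rho>)"
      then show "\<tau> \<in> {\<tau> \<in> boundary (Suc k) {\<sigma>}. \<rho> \<subseteq> \<tau>}"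
        using True fr that unfolding eq by auto
    qed
    moreover have "inj_on (\<lambda>x. insert x \<rho>) (\<sigma> - \<rho>)" by (auto simp: inj_on_def)
    ultimately have "card {\<tau> \<in> boundary (Suc k) {\<sigma>}. \<rho> \<subseteq> \<tau>} = card (\<sigma> - \<rho>)"
      by (simp add: card_image)
    also have "\<dots> = 2" using True fr that assms(3) by (simp add: card_Diff_subset)
    finally show ?thesis by simp
  next
    case False
    then have "{\<tau> \<in> boundary (Suc k) {\<sigma>}. \<rho> \<subseteq> \<tau>} = {}" unfolding eq by blast
    then show ?thesis by (simp del: Collect_empty_eq)
  qed
  then show "is_cycle k V (boundary (Suc k) {\<sigma>})"
    using assms(2) unfolding is_cycle_def by (auto simp: boundary_def[of k] eq)
qed

text \<open>If a forest contained \<open>T\<close> and a further simplex \<sigma>, then \<sigma> and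
  the filling of its boundary in \<open>T\<close> would form a nonzero cycle inside the
  forest.\<close>

lemma hypertree_cycle_basis:
  assumes "cycle_basis k {1..n} T"
  shows "hypertree (Suc k) n T"
proof -
  have simplices: "simplices (Suc k) n = {\<sigma>. \<sigma> \<subseteq> {1..n} \<and> card \<sigma> = Suc (Suc k)}"
    unfolding simplices_def by simp
  have "F = T" if F: "forest (Suc k) n F" "T \<subseteq> F" for F
  proof (rule ccontr)
    assume "F \<noteq> T"
    then obtain \<sigma> where \<sigma>: "\<sigma> \<in> F" "\<sigma> \<notin> T" using F(2) by auto
    have FS: "F \<subseteq> simplices (Suc k) n" using F(1) unfolding forest_def by simp
    then have "is_cycle k {1..n} (boundary (Suc k) {\<sigma>})"
      using \<sigma>(1) simplices by (intro is_cycle_simplex_boundary) auto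
    note X = filling_works[OF assms _ this]
    define X where "X = filling k (boundary (Suc k) {\<sigma>}) T"
    have XT: "X \<subseteq> T" "boundary (Suc k) X = boundary (Suc k) {\<sigma>}" using X unfolding X_def by auto
    have "X \<subseteq> {\<sigma>. \<sigma> \<subseteq> {1..n} \<and> card \<sigma> = Suc (Suc k)}" using XT(1) F(2) FS simplices by blast
    then have "finite X" by (rule finite_simplex_sets[rotated]) simp
    then have "boundary (Suc k) (sym_diff {\<sigma>} X) = {}"
      by (subst boundary_sym_diff) (simp_all add: XT(2))
    moreover have "sym_diff {\<sigma>} X \<noteq> {}" using XT(1) \<sigma>(2) by blast
    moreover have "sym_diff {\<sigma>} X \<subseteq> F" using XT(1) F(2) \<sigma>(1) by blast
    moreover from this have "sym_diff {\<sigma>} X \<subseteq> simplices (Suc k) n"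
      using FS by (rule order_trans)
    ultimately have "sym_diff {\<sigma>} X \<subseteq> F" "sym_diff {\<sigma>} X \<noteq> {}"
      "Defs.cycle (Suc k) n (sym_diff {\<sigma>} X)"
      unfolding Defs.cycle_def by (simp_all only: simp_thms)
    then show False using F(1) unfolding forest_def by blast
  qed
  moreover have "forest (Suc k) n T"
    using assms unfolding forest_def Defs.cycle_def cycle_basis_def simplices by blast
  ultimately show ?thesis unfolding hypertree_def by blast
qed

theorem theorem4:
  fixes d n :: nat
  assumes "d \<ge> 1" and "n \<ge> 1"
  shows "\<exists>T. hypertree d n T \<and> avg_fill d n T \<ge> c_const d * real ((n - 1) choose d)"
proof -
  obtain k where d: "d = Suc k" using assms(1) by (cases d) auto
  define b :: real where "b = 8 * (1/24) ^ (2 ^ k)"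
  define V where "V = {1..n}"
  define c where "c = real ((n - 1) choose d)"
  have V: "finite V" "card V = n" by (simp_all add: V_def)
  obtain p where p: "spread k b V p" using spread_exists[OF V(1)] unfolding b_def by blast
  have bases: "\<forall>T\<in>set_pmf p. cycle_basis k V T" using p unfolding spread_def by simp
  note fin = finite_cycle_bases[OF V(1) bases]
  \<comment> \<open>The expectation is taken of the sum over all simplices, so that a single
    \<open>T\<close> serves them jointly.\<close>
  obtain T where T: "T \<in> set_pmf p"
    "expect p (\<lambda>T. \<Sum>\<sigma>\<in>simplices d n. real (card (Fill d \<sigma> T))) \<le> (\<Sum>\<sigma>\<in>simplices d n. real (card (Fill d \<sigma> T)))"
    using expect_attained[OF fin] by blast
  have "b * c \<le> expect p (\<lambda>T. real (card (Fill d \<sigma> T)))" if "\<sigma> \<in> simplices d n" for \<sigma>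
  proof -
    have "\<sigma> \<subseteq> V" "card \<sigma> = Suc (Suc k)" using that unfolding simplices_def d V_def by auto
    then have "is_cycle k V (boundary d {\<sigma>})" "boundary d {\<sigma>} \<noteq> {}"
      using is_cycle_simplex_boundary[OF V(1)] unfolding d by auto
    \<comment> \<open>After unfolding, \<open>Fill d \<sigma> T\<close> is literally the filling of
      \<open>boundary d {\<sigma>}\<close>, a nonzero cycle to which \<open>spread\<close>
      applies.\<close>
    then show ?thesis
      using p unfolding spread_def Fill_def filling_def c_def d V(2) by simp
  qed
  then have "real (card (simplices d n)) * (b * c) \<le> (\<Sum>\<sigma>\<in>simplices d n. expect p (\<lambda>T. real (card (Fill d \<sigma> T))))"
    by (intro sum_bounded_below)
  also have "\<dots> = expect p (\<lambda>T. \<Sum>\<sigma>\<in>simplices d n. real (card (Fill d \<sigma> T)))"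
    using fin by (simp add: integrable_measure_pmf_finite)
  also note T(2)
  finally have "real (card (simplices d n)) * (b * c) \<le> (\<Sum>\<sigma>\<in>simplices d n. real (card (Fill d \<sigma> T)))" .
  moreover have "card (simplices d n) = n choose (d + 1)"
    unfolding simplices_def using n_subsets[of "{1..n}" "d + 1"] by simp
  ultimately have sum: "real (n choose (d + 1)) * (b * c) \<le> (\<Sum>\<sigma>\<in>simplices d n. real (card (Fill d \<sigma> T)))"
    by simp
  have "b * c \<le> avg_fill d n T"
  proof (cases "d + 1 \<le> n")
    case True
    then have "0 < real (n choose (d + 1))" by simp
    then show ?thesis using sum unfolding avg_fill_def by (simp add: field_simps)
  next
    case False
    \<comment> \<open>Here \<open>n - 1 < d\<close>, so the binomial vanishes and it suffices that
      the average is nonnegative.\<close>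
    then have "c = 0" using assms(2) by (simp add: c_def)
    then show ?thesis unfolding avg_fill_def by (simp add: sum_nonneg)
  qed
  moreover have "c_const d * c \<le> b * c"
    using c_const_le[of k] unfolding b_def d c_def by (intro mult_right_mono) simp_all
  moreover have "hypertree d n T"
    using hypertree_cycle_basis[of k n T] bases T(1) unfolding d V_def by blast
  ultimately show ?thesis unfolding c_def by (intro exI[of _ T]) simp
qed

end
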